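(* Let $\mathbb{K}$ be an algebraically closed field with $\operatorname{char}(\mathbb{K})\neq 2$. Let $G$ be a graph on $[n]$ obtained from an odd cycle $C_n$ by adding a chord, and let $R=\mathbb{K}[x_1,\dots,x_n,y_1,\dots,y_n]$. Then $\mathrm{v}(\mathcal{I}_G)\leq \operatorname{reg}(R/\mathcal{I}_G)$.
   Context: $C_n$ is the cycle on $n$ vertices; it is odd if $n$ is odd. A chord is an edge joining two vertices that are not adjacent in $C_n$. $R$ has the standard grading. The parity binomial edge ideal is $\mathcal{I}_G=(x_ix_j-y_iy_j:\{i,j\}\in E(G))\subseteq R$. For a graded ideal $I\subset R$, the $\mathrm{v}$-number is $\mathrm{v}(I)=\min\{d\ge 0:\exists f\in R_d \text{ and } \mathfrak p\in\mathrm{Ass}(I) \text{ with } I:f=\mathfrak p\}$, and $\operatorname{reg}(R/I)=\max\{j-i:\beta_{i,j}(R/I)\neq 0\}$ is the Castelnuovo–Mumford regularity. *)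

theory Defs
  imports
    "HOL-Library.Poly_Mapping"
    "HOL-Algebra.Ideal"
    "HOL-Algebra.Algebraic_Closure_Type"
    "Jordan_Normal_Form.Matrix_Kernel"
begin

section \<open>Polynomial rings\<close>

text \<open>The polynomial ring over \<open>'k\<close> whose variables are the elements of the type \<open>'v\<close>:
  finitely supported families of coefficients indexed by monomials (exponent vectors).
  As a HOL-Algebra structure, it is \<open>ring_of_type_algebra\<close> at this type.\<close>

type_synonym ('v, 'k) mpoly = "('v \<Rightarrow>\<^sub>0 nat) \<Rightarrow>\<^sub>0 'k"

definition var :: "'v \<Rightarrow> ('v, 'k::comm_ring_1) mpoly" where
  "var v = Poly_Mapping.single (Poly_Mapping.single v 1) 1"

definition mon_deg :: "('v \<Rightarrow>\<^sub>0 nat) \<Rightarrow> nat" where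
  "mon_deg m = (\<Sum>v\<in>Poly_Mapping.keys m. Poly_Mapping.lookup m v)"

text \<open>\<open>hom_component d\<close> is the degree \<open>d\<close> component of the standard grading; it contains \<open>0\<close>.\<close>

definition hom_component :: "nat \<Rightarrow> ('v, 'k::comm_ring_1) mpoly set" where
  "hom_component d = {f. \<forall>m\<in>Poly_Mapping.keys f. mon_deg m = d}"

text \<open>Homogeneous elements of degree \<open>b - a\<close>, where \<open>b - a\<close> is a difference of integers (so the
  set is \<open>{0}\<close> if \<open>b < a\<close>). These are the graded homomorphisms \<open>R(-b) \<rightarrow> R(-a)\<close>.\<close>

definition graded_maps :: "nat \<Rightarrow> nat \<Rightarrow> ('v, 'k::comm_ring_1) mpoly set" where
  "graded_maps b a = {f. \<forall>m\<in>Poly_Mapping.keys f. mon_deg m + a = b}"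

definition irrelevant_ideal :: "('v, 'k::comm_ring_1) mpoly set" where
  "irrelevant_ideal = {f. Poly_Mapping.lookup f 0 = 0}"


section \<open>The v-number\<close>

definition colon :: "'a::comm_ring_1 set \<Rightarrow> 'a \<Rightarrow> 'a set" where
  "colon I f = {g. g * f \<in> I}"

text \<open>As usual, \<open>Ass(I)\<close> means the set of associated primes of the module \<open>R/I\<close>, i.e. the primes
  that are the annihilator \<open>I : g\<close> of the class of some \<open>g\<close>.\<close>

definition Ass :: "'a::comm_ring_1 set \<Rightarrow> 'a set set" where
  "Ass I = {P. primeideal P ring_of_type_algebra \<and> (\<exists>g. P = colon I g)}"

definition v_number :: "('v, 'k::comm_ring_1) mpoly set \<Rightarrow> nat" where
  "v_number I = (LEAST d. \<exists>f\<in>hom_component d. \<exists>P\<in>Ass I. colon I f = P)"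


section \<open>Graded Betti numbers and regularity\<close>

text \<open>A complex \<open>\<dots> \<rightarrow> F\<^sub>2 \<rightarrow> F\<^sub>1 \<rightarrow> F\<^sub>0\<close> of free modules of finite rank together with an
  augmentation \<open>F\<^sub>0 \<rightarrow> R\<close>, to be composed with \<open>R \<rightarrow> R/I\<close>. Here \<open>F\<^sub>i\<close> is the direct sum of the
  \<open>R(-d)\<close> with \<open>d\<close> ranging over the list \<open>degs i\<close>, the matrix \<open>diff i\<close> describes
  \<open>F\<^sub>i\<^sub>+\<^sub>1 \<rightarrow> F\<^sub>i\<close>, and \<open>aug\<close> is the row of the augmentation. Natural numbers suffice for the
  degrees, since \<open>R/I\<close> has no elements of negative degree and so the generators in a minimal
  resolution have none either.\<close>

record (overloaded) ('v, 'k::zero) free_complex =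
  degs :: "nat \<Rightarrow> nat list"
  diff :: "nat \<Rightarrow> ('v, 'k) mpoly mat"
  aug :: "('v, 'k) mpoly vec"

definition rk :: "('v, 'k::zero) free_complex \<Rightarrow> nat \<Rightarrow> nat" where
  "rk F i = length (degs F i)"

definition diff_image :: "('v, 'k::comm_ring_1) free_complex \<Rightarrow> nat \<Rightarrow> ('v, 'k) mpoly vec set" where
  "diff_image F i = (\<lambda>w. diff F i *\<^sub>v w) ` carrier_vec (rk F (Suc i))"

definition graded_maps_ok :: "('v, 'k::comm_ring_1) free_complex \<Rightarrow> bool" where
  "graded_maps_ok F \<longleftrightarrow>
     aug F \<in> carrier_vec (rk F 0) \<and>
     (\<forall>r < rk F 0. aug F $ r \<in> graded_maps (degs F 0 ! r) 0) \<and>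
     (\<forall>i. diff F i \<in> carrier_mat (rk F i) (rk F (Suc i)) \<and>
          (\<forall>r < rk F i. \<forall>s < rk F (Suc i).
             diff F i $$ (r, s) \<in> graded_maps (degs F (Suc i) ! s) (degs F i ! r)))"

definition graded_free_resolution ::
    "('v, 'k::comm_ring_1) free_complex \<Rightarrow> ('v, 'k) mpoly set \<Rightarrow> bool" where
  "graded_free_resolution F I \<longleftrightarrow>
     graded_maps_ok F \<and>
     (\<forall>g. \<exists>v\<in>carrier_vec (rk F 0). aug F \<bullet> v - g \<in> I) \<and>
     {v \<in> carrier_vec (rk F 0). aug F \<bullet> v \<in> I} = diff_image F 0 \<and>
     (\<forall>i. mat_kernel (diff F i) = diff_image F (Suc i))"

definition minimal_graded_free_resolution ::
    "('v, 'k::comm_ring_1) free_complex \<Rightarrow> ('v, 'k) mpoly set \<Rightarrow> bool" where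
  "minimal_graded_free_resolution F I \<longleftrightarrow>
     graded_free_resolution F I \<and>
     (\<forall>i. elements_mat (diff F i) \<subseteq> irrelevant_ideal)"

text \<open>For a homogeneous ideal \<open>I\<close>, the numbers \<open>\<beta>\<^sub>i\<^sub>,\<^sub>j(R/I)\<close> and \<open>reg(R/I)\<close>. Over a field and with
  finitely many variables, a minimal graded free resolution exists and is unique up to graded
  isomorphism, so the choice made here does not matter.\<close>

definition betti :: "('v, 'k::comm_ring_1) mpoly set \<Rightarrow> nat \<Rightarrow> nat \<Rightarrow> nat" where
  "betti I i j = count_list (degs (SOME F. minimal_graded_free_resolution F I) i) j"

definition reg :: "('v, 'k::comm_ring_1) mpoly set \<Rightarrow> int" where
  "reg I = Max {int j - int i | i j. betti I i j \<noteq> 0}"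


section \<open>Graphs and parity binomial edge ideals\<close>

text \<open>A graph on the vertex set \<open>'v\<close> is given by its set of edges, which are two-element sets.
  The polynomial ring in the variables \<open>x\<^sub>i\<close>, \<open>y\<^sub>i\<close> has the type \<open>'v + 'v\<close> of variables: \<open>Inl i\<close>
  stands for \<open>x\<^sub>i\<close> and \<open>Inr i\<close> for \<open>y\<^sub>i\<close>.\<close>

definition parity_binomial_edge_ideal :: "'v set set \<Rightarrow> ('v + 'v, 'k::comm_ring_1) mpoly set" where
  "parity_binomial_edge_ideal E =
     Idl\<^bsub>ring_of_type_algebra\<^esub>
       {var (Inl i) * var (Inl j) - var (Inr i) * var (Inr j) | i j. {i, j} \<in> E}"

text \<open>\<open>C\<close> is the edge set of a cycle on \<open>n\<close> vertices passing through all elements of \<open>'v\<close>;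
  in particular \<open>CARD('v) = n\<close>.\<close>

definition cycle_graph :: "nat \<Rightarrow> 'v set set \<Rightarrow> bool" where
  "cycle_graph n C \<longleftrightarrow>
     3 \<le> n \<and>
     (\<exists>c. bij_betw c {0..<n} (UNIV :: 'v set) \<and> C = {{c i, c (Suc i mod n)} | i. i < n})"

end

theory Submission
  imports Defs "HOL-Library.Countable_Set"
begin

text \<open>
  Number the vertices \<open>0, \<dots>, n - 1\<close> along the cycle so that the chord is \<open>{0, L}\<close> with \<open>L\<close> even,
  \<open>2 \<le> L \<le> n - 3\<close>. Both sides are compared with \<open>n - 2\<close>.

  Upper bound for the v-number: the prime \<open>P = (x\<^sub>i - y\<^sub>i : i)\<close> is \<open>I : f\<close> for the product \<open>f\<close> of the
  \<open>n - 2\<close> forms \<open>x\<^sub>i + y\<^sub>i\<close>, \<open>i < n - 2\<close>. Indeed \<open>f \<notin> P \<supseteq> I\<close>; and \<open>f\<close> kills \<open>x\<^sub>i - y\<^sub>i\<close> modulo \<open>I\<close> because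
  the vertices \<open>i < n - 2\<close> span a connected graph with the odd cycle \<open>0, \<dots>, L\<close>, and the two remaining
  vertices are adjacent to it.

  Lower bound for the regularity: deleting the vertex \<open>0\<close> leaves a path, whose \<open>n - 2\<close> edge binomials
  \<open>g\<^sub>k\<close> form a regular sequence modulo \<open>J = (x\<^sub>0, y\<^sub>0)\<close> with \<open>I \<subseteq> J + (g\<^sub>k : k)\<close>. Dividing out the \<open>g\<^sub>k\<close> one
  after the other, the connecting maps carry the class of \<open>1\<close> in \<open>Hom(R/I, R/(J + (g\<^sub>k : k)))\<close> to a
  nonzero class of degree \<open>-2(n - 2)\<close> in \<open>Ext\<^bsup>n-2\<^esup>(R/I, R/J)\<close>, so every graded free resolution of
  \<open>R/I\<close> has a generator of degree at least \<open>2(n - 2)\<close> in homological degree \<open>n - 2\<close>.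

  Since the regularity is a maximum over a chosen minimal resolution, one also needs that such a
  resolution exists (via Dickson's lemma) and that it is finite (Hilbert's syzygy theorem).
\<close>

text \<open>Vertex 0 is deleted because it is an end of the chord: modulo x_0 and y_0 only a path is
  left of the graph, and interchanging x and y at every other vertex gives its edge binomials
  pairwise coprime leading monomials. That is where the regular sequence comes from. Each of the n -
  2 edges raises the homological degree by 1 and the internal degree by 2, hence the contribution n
  - 2 to the regularity.

  Evenness of L is a matter of signs: the odd closed walk through the chord identifies an element
  with its own negative modulo I, and this is where 2 has to be inverted.

  Ext is never formed as a module. Its classes are rows of polynomials on the terms of the
  resolution, taken modulo an ideal; all that is needed is that elements of I act as zero, and this
  is an explicit homotopy. Degrees enter through homogeneity alone: a nonzero entry of degree b -
  2(n - 2) on a generator of degree b forces b to be at least 2(n - 2).\<close>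

no_notation fps_nth (infixl "$" 75)

abbreviation (input) lookup :: "('a \<Rightarrow>\<^sub>0 'b::zero) \<Rightarrow> 'a \<Rightarrow> 'b" where
  "lookup \<equiv> Poly_Mapping.lookup"

abbreviation (input) keys :: "('a \<Rightarrow>\<^sub>0 'b::zero) \<Rightarrow> 'a set" where
  "keys \<equiv> Poly_Mapping.keys"

section \<open>Monomials, graded parts and pushforward\<close>

lemma mon_deg_eq_sum:
  fixes m :: "'v::finite \<Rightarrow>\<^sub>0 nat"
  shows "mon_deg m = (\<Sum>v\<in>UNIV. Poly_Mapping.lookup m v)"
  unfolding mon_deg_def by (rule sum.mono_neutral_left) (auto simp: Poly_Mapping.in_keys_iff)

lemma mon_deg_add [simp]:
  fixes m :: "'v::finite \<Rightarrow>\<^sub>0 nat"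
  shows "mon_deg (m + m') = mon_deg m + mon_deg m'"
  by (simp add: mon_deg_eq_sum lookup_add sum.distrib)

lemma mon_deg_single [simp]: "mon_deg (Poly_Mapping.single v k) = k"
  by (simp add: mon_deg_def)

lemma mon_deg_0 [simp]: "mon_deg 0 = 0"
  by (simp add: mon_deg_def)

lemma mon_deg_eq_0_iff: "mon_deg m = 0 \<longleftrightarrow> m = 0"
  by (auto simp: mon_deg_def Poly_Mapping.in_keys_iff intro!: poly_mapping_eqI)

lemma finite_mon_deg_le: "finite {m :: 'v::finite \<Rightarrow>\<^sub>0 nat. mon_deg m \<le> d}"
proof (rule finite_subset)
  show "{m :: 'v \<Rightarrow>\<^sub>0 nat. mon_deg m \<le> d} \<subseteq> Abs_poly_mapping ` (Pi\<^sub>E UNIV (\<lambda>_. {..d}))"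
  proof
    fix m :: "'v \<Rightarrow>\<^sub>0 nat"
    assume "m \<in> {m. mon_deg m \<le> d}"
    then have le: "mon_deg m \<le> d" by simp
    have "lookup m v \<le> mon_deg m" for v
      unfolding mon_deg_eq_sum by (rule member_le_sum) auto
    with le have "lookup m \<in> Pi\<^sub>E UNIV (\<lambda>_. {..d})"
      by (auto intro: order_trans)
    moreover have "m = Abs_poly_mapping (lookup m)"
      by (simp add: poly_mapping.lookup_inverse)
    ultimately show "m \<in> Abs_poly_mapping ` (Pi\<^sub>E UNIV (\<lambda>_. {..d}))"
      by blast
  qed
  show "finite (Abs_poly_mapping ` (Pi\<^sub>E (UNIV::'v set) (\<lambda>_. {..d})))"
    by (intro finite_imageI finite_PiE) auto
qed

lemma poly_mapping_sum_single:
  fixes f :: "'a \<Rightarrow>\<^sub>0 'b::comm_monoid_add"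
  shows "(\<Sum>m\<in>keys f. Poly_Mapping.single m (lookup f m)) = f"
proof (rule poly_mapping_eqI)
  fix k
  have "lookup (\<Sum>m\<in>keys f. Poly_Mapping.single m (lookup f m)) k =
      (\<Sum>m\<in>keys f. if m = k then lookup f m else 0)"
    by (simp add: lookup_sum lookup_single when_def)
  also have "\<dots> = lookup f k"
    by (simp add: sum.delta Poly_Mapping.in_keys_iff)
  finally show "lookup (\<Sum>m\<in>keys f. Poly_Mapping.single m (lookup f m)) k = lookup f k" .
qed

lemma poly_mapping_additive_induct [case_names zero add single]:
  fixes f :: "'a \<Rightarrow>\<^sub>0 'b::comm_monoid_add"
  assumes "P 0" and "\<And>f g. P f \<Longrightarrow> P g \<Longrightarrow> P (f + g)"
    and "\<And>m c. m \<in> keys f \<Longrightarrow> P (Poly_Mapping.single m c)"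
  shows "P f"
proof -
  have "P (\<Sum>m\<in>A. Poly_Mapping.single m (lookup f m))" if "A \<subseteq> keys f" for A
    using finite_subset[OF that Poly_Mapping.finite_keys] that
    by (induction A rule: finite_induct) (use assms in auto)
  from this[of "keys f"] show ?thesis by (simp add: poly_mapping_sum_single)
qed

lemma lookup_times_single_add:
  fixes f :: "'a::cancel_comm_monoid_add \<Rightarrow>\<^sub>0 'b::comm_semiring_1"
  shows "lookup (f * Poly_Mapping.single k c) (m + k) = lookup f m * c"
proof -
  have "f * Poly_Mapping.single k c =
      (\<Sum>m\<in>keys f. Poly_Mapping.single m (lookup f m)) * Poly_Mapping.single k c"
    by (simp only: poly_mapping_sum_single)
  also have "\<dots> = (\<Sum>m\<in>keys f. Poly_Mapping.single (m + k) (lookup f m * c))"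
    by (simp add: sum_distrib_right mult_single)
  finally have "lookup (f * Poly_Mapping.single k c) (m + k) =
      (\<Sum>m'\<in>keys f. if m' = m then lookup f m' * c else 0)"
    by (simp add: lookup_sum lookup_single when_def)
  then show ?thesis
    by (simp add: sum.delta Poly_Mapping.in_keys_iff)
qed

lemma keys_times_single:
  fixes f :: "'a::cancel_comm_monoid_add \<Rightarrow>\<^sub>0 'b::comm_semiring_1"
  assumes "M \<in> keys (f * Poly_Mapping.single k c)"
  obtains m where "m \<in> keys f" "M = m + k"
proof -
  from assms keys_mult[of f "Poly_Mapping.single k c"]
  obtain a b where "a \<in> keys f" "b \<in> keys (Poly_Mapping.single k c)" "M = a + b" by blast
  then show thesis using that by (auto split: if_splits)
qed

lemma keys_minusE:
  fixes f g :: "'a \<Rightarrow>\<^sub>0 'b::ab_group_add"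
  assumes "m \<in> keys (f - g)"
  shows "m \<in> keys f \<or> m \<in> keys g"
  using assms by (auto simp: Poly_Mapping.in_keys_iff lookup_minus)

lemma keys_addE:
  assumes "m \<in> keys (f + g)"
  shows "m \<in> keys f \<or> m \<in> keys g"
  using assms keys_add[of f g] by blast

lemma keys_multE:
  assumes "M \<in> keys (f * g)"
  obtains a b where "a \<in> keys f" "b \<in> keys g" "M = a + b"
  using assms keys_mult[of f g] by blast

text \<open>The projection onto degree b - a, with a sum in place of the difference so that no
  truncated subtraction occurs when b < a.\<close>

definition graded_part :: "nat \<Rightarrow> nat \<Rightarrow> ('v, 'k::comm_ring_1) mpoly \<Rightarrow> ('v, 'k) mpoly" where
  "graded_part b a f = Poly_Mapping.mapp (\<lambda>m c. if mon_deg m + a = b then c else 0) f"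

lemma lookup_graded_part:
  "lookup (graded_part b a f) m = (if mon_deg m + a = b then lookup f m else 0)"
  by (auto simp: graded_part_def lookup_mapp when_def Poly_Mapping.in_keys_iff)

lemma graded_part_in: "graded_part b a f \<in> graded_maps b a"
  by (auto simp: graded_maps_def Poly_Mapping.in_keys_iff lookup_graded_part split: if_splits)

lemma graded_part_id: "f \<in> graded_maps b a \<Longrightarrow> graded_part b a f = f"
  by (rule poly_mapping_eqI) (auto simp: graded_maps_def Poly_Mapping.in_keys_iff lookup_graded_part)

lemma graded_part_0 [simp]: "graded_part b a 0 = 0"
  by (rule poly_mapping_eqI) (simp add: lookup_graded_part)

lemma graded_part_add: "graded_part b a (f + g) = graded_part b a f + graded_part b a g"
  by (rule poly_mapping_eqI) (simp add: lookup_graded_part lookup_add)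

lemma graded_part_sum: "graded_part b a (sum f A) = (\<Sum>x\<in>A. graded_part b a (f x))"
  by (induction A rule: infinite_finite_induct) (auto simp: graded_part_add)

text \<open>Multiplication by \<open>g\<close> shifts degrees by b - a, so it maps the chosen part
  of \<open>c\<close> to the chosen part of the product and all other parts elsewhere.\<close>

lemma graded_part_mult:
  fixes g :: "('v::finite, 'k::comm_ring_1) mpoly"
  assumes "g \<in> graded_maps b a"
  shows "graded_part d a (g * c) = g * graded_part d b c"
proof -
  let ?p = "graded_part d b c"
  have "g * ?p \<in> graded_maps d a"
    unfolding graded_maps_def
  proof (clarify elim!: keys_multE)
    fix x y assume "x \<in> keys g" "y \<in> keys ?p"
    then have "mon_deg x + a = b" "mon_deg y + b = d"
      using assms graded_part_in[of d b c] by (auto simp: graded_maps_def)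
    then show "mon_deg (x + y) + a = d" by simp
  qed
  then have 1: "graded_part d a (g * ?p) = g * ?p" by (rule graded_part_id)
  have 2: "graded_part d a (g * (c - ?p)) = 0"
  proof (rule poly_mapping_eqI)
    fix m
    have "mon_deg m + a \<noteq> d" if "m \<in> keys (g * (c - ?p))"
      using that
    proof (rule keys_multE)
      fix x y assume "x \<in> keys g" "y \<in> keys (c - ?p)" "m = x + y"
      then have "mon_deg x + a = b" "mon_deg y + b \<noteq> d"
        using assms by (auto simp: graded_maps_def Poly_Mapping.in_keys_iff lookup_minus lookup_graded_part)
      then show ?thesis using \<open>m = x + y\<close> by auto
    qed
    then show "lookup (graded_part d a (g * (c - ?p))) m = lookup 0 m"
      by (auto simp: lookup_graded_part Poly_Mapping.in_keys_iff)
  qed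
  have "g * c = g * ?p + g * (c - ?p)" by (simp add: algebra_simps)
  then show ?thesis using 1 2 by (simp only: graded_part_add) simp
qed

lemma graded_maps_mult:
  fixes f :: "('v::finite, 'k::comm_ring_1) mpoly"
  assumes "f \<in> graded_maps b a" "g \<in> graded_maps c b"
  shows "f * g \<in> graded_maps c a"
  using assms by (fastforce simp: graded_maps_def elim!: keys_multE)

lemma graded_maps_0 [simp]: "0 \<in> graded_maps b a"
  by (simp add: graded_maps_def)

lemma graded_maps_add: "f \<in> graded_maps b a \<Longrightarrow> g \<in> graded_maps b a \<Longrightarrow> f + g \<in> graded_maps b a"
  by (auto simp: graded_maps_def dest: keys_addE)

lemma graded_maps_minus: "f \<in> graded_maps b a \<Longrightarrow> g \<in> graded_maps b a \<Longrightarrow> f - g \<in> graded_maps b a"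
  by (auto simp: graded_maps_def dest: keys_minusE)

lemma graded_maps_sum: "(\<And>x. x \<in> A \<Longrightarrow> f x \<in> graded_maps b a) \<Longrightarrow> sum f A \<in> graded_maps b a"
  by (induction A rule: infinite_finite_induct) (auto intro: graded_maps_add)

lemma graded_maps_single: "mon_deg m + a = b \<Longrightarrow> Poly_Mapping.single m c \<in> graded_maps b a"
  by (simp add: graded_maps_def)

lemma sum_graded_part:
  fixes f :: "('v::finite, 'k::comm_ring_1) mpoly"
  assumes "\<And>m. m \<in> keys f \<Longrightarrow> mon_deg m + a \<le> N"
  shows "(\<Sum>b\<le>N. graded_part b a f) = f"
proof (rule poly_mapping_eqI)
  fix m
  have "lookup (\<Sum>b\<le>N. graded_part b a f) m = (\<Sum>b\<le>N. if b = mon_deg m + a then lookup f m else 0)"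
    by (simp add: lookup_sum lookup_graded_part eq_commute[of "_ + _"])
  also have "\<dots> = lookup f m"
    using assms[of m] by (auto simp: sum.delta Poly_Mapping.in_keys_iff)
  finally show "lookup (\<Sum>b\<le>N. graded_part b a f) m = lookup f m" .
qed

lemma var_mult: "var v * var w = Poly_Mapping.single (Poly_Mapping.single v 1 + Poly_Mapping.single w 1) 1"
  by (simp add: var_def mult_single)

section \<open>Pushforward along maps of monomials\<close>

text \<open>The linear extension of a map of exponents, a ring homomorphism if that map is additive.
  It serves both for the injective \<open>lex_code\<close> and for the substitution
  \<open>fold_mon\<close>, which merges monomials.\<close>

definition push :: "('a \<Rightarrow> 'b) \<Rightarrow> ('a \<Rightarrow>\<^sub>0 'k::comm_semiring_1) \<Rightarrow> ('b \<Rightarrow>\<^sub>0 'k)" where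
  "push \<pi> f = (\<Sum>m\<in>keys f. Poly_Mapping.single (\<pi> m) (lookup f m))"

lemma push_superset:
  assumes "finite A" "keys f \<subseteq> A"
  shows "push \<pi> f = (\<Sum>m\<in>A. Poly_Mapping.single (\<pi> m) (lookup f m))"
  unfolding push_def using assms by (intro sum.mono_neutral_left) (auto simp: Poly_Mapping.in_keys_iff)

lemma push_0 [simp]: "push \<pi> 0 = 0"
  by (simp add: push_def)

lemma push_single [simp]: "push \<pi> (Poly_Mapping.single m c) = Poly_Mapping.single (\<pi> m) c"
  by (simp add: push_def)

lemma push_add: "push \<pi> (f + g) = push \<pi> f + push \<pi> g"
  using keys_add[of f g]
  by (simp add: push_superset[of "keys f \<union> keys g"] lookup_add single_add sum.distrib)

lemma push_mult:
  assumes "\<And>a b. \<pi> (a + b) = \<pi> a + \<pi> b"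
  shows "push \<pi> (f * g) = push \<pi> f * push \<pi> g"
proof (induction f rule: poly_mapping_additive_induct)
  case (single m c)
  show ?case
    by (induction g rule: poly_mapping_additive_induct)
      (simp_all add: push_add distrib_left mult_single assms)
qed (simp_all add: push_add distrib_right)

lemma lookup_push_inj: "inj \<pi> \<Longrightarrow> lookup (push \<pi> f) (\<pi> m) = lookup f m"
  by (induction f rule: poly_mapping_additive_induct)
    (simp_all add: push_add lookup_add lookup_single when_def inj_eq)

lemma push_eq_0D: "inj \<pi> \<Longrightarrow> push \<pi> f = 0 \<Longrightarrow> f = 0"
  by (metis lookup_push_inj lookup_zero poly_mapping_eqI)

text \<open>Re-indexing the variables by natural numbers makes the lexicographic order of
  \<open>Poly_Mapping\<close>, and hence its \<open>idom\<close> instance, available for any finite set of variables.\<close>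

definition lex_code :: "('v::finite \<Rightarrow>\<^sub>0 nat) \<Rightarrow> (nat \<Rightarrow>\<^sub>0 nat)" where
  "lex_code m = (\<Sum>v\<in>UNIV. Poly_Mapping.single (to_nat_on UNIV v) (lookup m v))"

lemma lex_code_add: "lex_code (a + b) = lex_code a + lex_code b"
  by (simp add: lex_code_def lookup_add single_add sum.distrib)

lemma inj_lex_code: "inj (lex_code :: ('v::finite \<Rightarrow>\<^sub>0 nat) \<Rightarrow> _)"
proof (rule injI, rule poly_mapping_eqI)
  fix a b :: "'v \<Rightarrow>\<^sub>0 nat" and v
  have *: "lookup (lex_code a) (to_nat_on UNIV v) = lookup a v" for a :: "'v \<Rightarrow>\<^sub>0 nat"
    by (simp add: lex_code_def lookup_sum lookup_single when_def sum.delta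
        inj_on_eq_iff[OF inj_on_to_nat_on])
  assume "lex_code a = lex_code b"
  then show "lookup a v = lookup b v" using *[of a] *[of b] by simp
qed

lemma mpoly_no_zero_divisors:
  fixes f g :: "('v::finite, 'k::field) mpoly"
  assumes "f * g = 0"
  shows "f = 0 \<or> g = 0"
proof -
  have "push lex_code f * push lex_code g = 0"
    using assms push_mult[of lex_code f g] by (simp add: lex_code_add)
  then have "push lex_code f = 0 \<or> push lex_code g = 0" by simp
  then show ?thesis using push_eq_0D[OF inj_lex_code] by blast
qed


section \<open>Existence of minimal graded free resolutions\<close>

text \<open>Induction on the coordinates: \<open>L1\<close> works for \<open>S\<close>, and it also
  handles every \<open>l\<close> whose new coordinate is at least the maximum \<open>N\<close>
  attained in \<open>L1\<close>. The finitely many smaller values of that coordinate give slices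
  \<open>K i\<close>, again covered by induction.\<close>

lemma dickson:
  fixes L :: "('v \<Rightarrow>\<^sub>0 nat) set"
  assumes "finite S"
  shows "\<exists>L0. finite L0 \<and> L0 \<subseteq> L \<and> (\<forall>l\<in>L. \<exists>l0\<in>L0. \<forall>v\<in>S. lookup l0 v \<le> lookup l v)"
  using assms
proof (induction S arbitrary: L rule: finite_induct)
  case empty
  show ?case
  proof (cases "L = {}")
    case False
    then obtain l where "l \<in> L" by blast
    then show ?thesis by (intro exI[of _ "{l}"]) auto
  qed auto
next
  case (insert x S)
  obtain L1 where L1: "finite L1" "L1 \<subseteq> L" "\<And>l. l \<in> L \<Longrightarrow> \<exists>l0\<in>L1. \<forall>v\<in>S. lookup l0 v \<le> lookup l v"
    using insert.IH[of L] by blast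
  define N where "N = Max (insert 0 ((\<lambda>l. lookup l x) ` L1))"
  have N: "lookup l x \<le> N" if "l \<in> L1" for l
    unfolding N_def using L1(1) that by (intro Max_ge) auto
  have "\<forall>i. \<exists>L0. finite L0 \<and> L0 \<subseteq> {l\<in>L. lookup l x = i} \<and>
      (\<forall>l\<in>{l\<in>L. lookup l x = i}. \<exists>l0\<in>L0. \<forall>v\<in>S. lookup l0 v \<le> lookup l v)"
    using insert.IH by blast
  from choice[OF this] obtain K where K0: "\<forall>i. finite (K i) \<and> K i \<subseteq> {l\<in>L. lookup l x = i} \<and>
      (\<forall>l\<in>{l\<in>L. lookup l x = i}. \<exists>l0\<in>K i. \<forall>v\<in>S. lookup l0 v \<le> lookup l v)" ..
  have K: "finite (K i)" "K i \<subseteq> {l\<in>L. lookup l x = i}"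
    "l \<in> L \<Longrightarrow> lookup l x = i \<Longrightarrow> \<exists>l0\<in>K i. \<forall>v\<in>S. lookup l0 v \<le> lookup l v" for i l
    using K0[rule_format, of i] by auto
  show ?case
  proof (intro exI[of _ "L1 \<union> (\<Union>i<N. K i)"] conjI ballI)
    fix l assume l: "l \<in> L"
    show "\<exists>l0\<in>L1 \<union> (\<Union>i<N. K i). \<forall>v\<in>insert x S. lookup l0 v \<le> lookup l v"
    proof (cases "lookup l x < N")
      case True
      obtain l0 where "l0 \<in> K (lookup l x)" "\<forall>v\<in>S. lookup l0 v \<le> lookup l v"
        using K(3)[OF l refl] by blast
      moreover from this have "lookup l0 x = lookup l x" using K(2) by blast
      ultimately show ?thesis using True by (intro bexI[of _ l0]) auto
    next
      case False
      obtain l0 where l0: "l0 \<in> L1" "\<forall>v\<in>S. lookup l0 v \<le> lookup l v"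
        using L1(3)[OF l] by blast
      with N[of l0] False show ?thesis by (intro bexI[of _ l0]) auto
    qed
  qed (use L1 K(1) in \<open>auto dest: subsetD[OF K(2)]\<close>)
qed

section \<open>Submodules of free modules and their graded parts\<close>

definition submodule_vec :: "nat \<Rightarrow> 'a::comm_ring_1 vec set \<Rightarrow> bool" where
  "submodule_vec r N \<longleftrightarrow> N \<subseteq> carrier_vec r \<and> 0\<^sub>v r \<in> N \<and>
     (\<forall>u\<in>N. \<forall>v\<in>N. u + v \<in> N) \<and> (\<forall>c. \<forall>v\<in>N. c \<cdot>\<^sub>v v \<in> N)"

lemma submodule_vecD:
  assumes "submodule_vec r N"
  shows "v \<in> N \<Longrightarrow> v \<in> carrier_vec r" "0\<^sub>v r \<in> N"
    "u \<in> N \<Longrightarrow> v \<in> N \<Longrightarrow> u + v \<in> N" "v \<in> N \<Longrightarrow> c \<cdot>\<^sub>v v \<in> N"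
  using assms by (auto simp: submodule_vec_def)

lemma submodule_vec_sum:
  fixes f :: "nat \<Rightarrow> nat \<Rightarrow> 'a::comm_ring_1"
  assumes N: "submodule_vec r N" and "\<And>s. s < n \<Longrightarrow> vec r (f s) \<in> N"
  shows "vec r (\<lambda>t. \<Sum>s<n. f s t) \<in> N"
  using assms(2)
proof (induction n)
  case 0
  have "vec r (\<lambda>t. \<Sum>s<0. f s t) = 0\<^sub>v r" by (intro eq_vecI) auto
  then show ?case using submodule_vecD(2)[OF N] by simp
next
  case (Suc n)
  have "vec r (\<lambda>t. \<Sum>s<Suc n. f s t) = vec r (\<lambda>t. \<Sum>s<n. f s t) + vec r (f n)"
    by (intro eq_vecI) auto
  also have "\<dots> \<in> N" using Suc by (intro submodule_vecD(3)[OF N]) auto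
  finally show ?case .
qed

lemma submodule_vec_mult_mat_vec:
  assumes N: "submodule_vec r N" and A: "A \<in> carrier_mat r n" and w: "w \<in> carrier_vec n"
    and cols: "\<And>s. s < n \<Longrightarrow> w $ s \<cdot>\<^sub>v col A s \<in> N"
  shows "A *\<^sub>v w \<in> N"
proof -
  have "vec r (\<lambda>t. \<Sum>s<n. A $$ (t, s) * w $ s) \<in> N"
  proof (rule submodule_vec_sum[OF N])
    fix s assume s: "s < n"
    have "vec r (\<lambda>t. A $$ (t, s) * w $ s) = w $ s \<cdot>\<^sub>v col A s"
      using A s by (intro eq_vecI) auto
    then show "vec r (\<lambda>t. A $$ (t, s) * w $ s) \<in> N" using cols[OF s] by simp
  qed
  also have "vec r (\<lambda>t. \<Sum>s<n. A $$ (t, s) * w $ s) = A *\<^sub>v w"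
    using A w by (intro eq_vecI) (auto simp: scalar_prod_def lessThan_atLeast0)
  finally show ?thesis .
qed

lemma mult_mat_smult_vec:
  fixes A :: "'a::comm_ring_1 mat"
  assumes "A \<in> carrier_mat r n" "v \<in> carrier_vec n"
  shows "A *\<^sub>v (c \<cdot>\<^sub>v v) = c \<cdot>\<^sub>v (A *\<^sub>v v)"
  using assms by (intro eq_vecI) (auto simp: scalar_prod_def sum_distrib_left algebra_simps)

lemma submodule_vec_image:
  fixes A :: "'a::comm_ring_1 mat"
  assumes A: "A \<in> carrier_mat r n"
  shows "submodule_vec r ((\<lambda>w. A *\<^sub>v w) ` carrier_vec n)"
  unfolding submodule_vec_def
proof (intro conjI ballI allI)
  show "0\<^sub>v r \<in> (\<lambda>w. A *\<^sub>v w) ` carrier_vec n"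
    using A by (intro image_eqI[of _ _ "0\<^sub>v n"]) auto
next
  fix u v assume "u \<in> (\<lambda>w. A *\<^sub>v w) ` carrier_vec n" "v \<in> (\<lambda>w. A *\<^sub>v w) ` carrier_vec n"
  then obtain a b where "a \<in> carrier_vec n" "b \<in> carrier_vec n" "u = A *\<^sub>v a" "v = A *\<^sub>v b" by blast
  then show "u + v \<in> (\<lambda>w. A *\<^sub>v w) ` carrier_vec n"
    using A by (intro image_eqI[of _ _ "a + b"]) (auto simp: mult_add_distrib_mat_vec)
next
  fix c v assume "v \<in> (\<lambda>w. A *\<^sub>v w) ` carrier_vec n"
  then obtain b where "b \<in> carrier_vec n" "v = A *\<^sub>v b" by blast
  then show "c \<cdot>\<^sub>v v \<in> (\<lambda>w. A *\<^sub>v w) ` carrier_vec n"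
    using A by (intro image_eqI[of _ _ "c \<cdot>\<^sub>v b"]) (auto simp: mult_mat_smult_vec[OF A])
qed (use A in auto)

lemma submodule_vec_kernel:
  fixes A :: "'a::comm_ring_1 mat"
  assumes A: "A \<in> carrier_mat r n"
  shows "submodule_vec n (mat_kernel A)"
proof -
  have "c \<cdot>\<^sub>v 0\<^sub>v r = (0\<^sub>v r :: 'a vec)" for c by (intro eq_vecI) auto
  then show ?thesis unfolding submodule_vec_def mat_kernel[OF A]
    using A by (auto simp: mult_add_distrib_mat_vec mult_mat_smult_vec[OF A])
qed

definition vec_part :: "nat \<Rightarrow> nat list \<Rightarrow> ('v, 'k::comm_ring_1) mpoly vec \<Rightarrow> ('v, 'k) mpoly vec" where
  "vec_part b ds v = vec (length ds) (\<lambda>s. graded_part b (ds ! s) (v $ s))"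

definition homogeneous_vec :: "nat \<Rightarrow> nat list \<Rightarrow> ('v, 'k::comm_ring_1) mpoly vec \<Rightarrow> bool" where
  "homogeneous_vec b ds v \<longleftrightarrow> v \<in> carrier_vec (length ds) \<and>
     (\<forall>s<length ds. v $ s \<in> graded_maps b (ds ! s))"

definition graded_submodule :: "nat list \<Rightarrow> ('v, 'k::comm_ring_1) mpoly vec set \<Rightarrow> bool" where
  "graded_submodule ds M \<longleftrightarrow> submodule_vec (length ds) M \<and> (\<forall>v\<in>M. \<forall>b. vec_part b ds v \<in> M)"

definition graded_mat :: "nat list \<Rightarrow> nat list \<Rightarrow> ('v, 'k::comm_ring_1) mpoly mat \<Rightarrow> bool" where
  "graded_mat ds es A \<longleftrightarrow> A \<in> carrier_mat (length ds) (length es) \<and>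
     (\<forall>r<length ds. \<forall>s<length es. A $$ (r, s) \<in> graded_maps (es ! s) (ds ! r))"

lemma homogeneous_vec_part: "homogeneous_vec b ds (vec_part b ds v)"
  by (simp add: homogeneous_vec_def vec_part_def graded_part_in)

text \<open>A vector is the sum of its finitely many nonzero graded parts, and these stay in a
  graded submodule.\<close>

lemma graded_submodule_subsetI:
  fixes M N :: "('v::finite, 'k::comm_ring_1) mpoly vec set"
  assumes M: "graded_submodule ds M" and N: "submodule_vec (length ds) N"
    and hom: "\<And>b v. v \<in> M \<Longrightarrow> homogeneous_vec b ds v \<Longrightarrow> v \<in> N"
  shows "M \<subseteq> N"
proof
  fix v assume v: "v \<in> M"
  define Y where "Y = (\<Union>s<length ds. (\<lambda>m. mon_deg m + ds ! s) ` keys (v $ s))"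
  have "finite Y" by (simp add: Y_def)
  then obtain B where "\<And>x. x \<in> Y \<Longrightarrow> x \<le> B" by (meson finite_nat_set_iff_bounded_le)
  then have B: "mon_deg m + ds ! s \<le> B" if "s < length ds" "m \<in> keys (v $ s)" for s m
    using that by (auto simp: Y_def)
  have "vec (length ds) (\<lambda>s. \<Sum>b<Suc B. graded_part b (ds ! s) (v $ s)) \<in> N"
  proof (rule submodule_vec_sum[OF N])
    fix b
    show "vec (length ds) (\<lambda>s. graded_part b (ds ! s) (v $ s)) \<in> N"
      using hom[OF _ homogeneous_vec_part] v M
      by (simp add: graded_submodule_def vec_part_def)
  qed
  also have "vec (length ds) (\<lambda>s. \<Sum>b<Suc B. graded_part b (ds ! s) (v $ s)) = v"
    using v M B by (intro eq_vecI)
      (auto simp: graded_submodule_def submodule_vec_def lessThan_Suc_atMost sum_graded_part simp del: sum.lessThan_Suc)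
  finally show "v \<in> N" .
qed

section \<open>Leading monomials, finite generation and minimal covers\<close>

text \<open>The monomial order is pulled back along \<open>lex_code\<close>. Only linearity and
  compatibility with addition are needed of it; termination of the division below comes from bounded
  degrees.\<close>

definition is_lead :: "('v::finite \<Rightarrow>\<^sub>0 nat) \<Rightarrow> ('v, 'k::zero) mpoly \<Rightarrow> bool" where
  "is_lead m f \<longleftrightarrow> m \<in> keys f \<and> (\<forall>m'\<in>keys f. lex_code m' \<le> lex_code m)"

lemma ex_is_lead:
  assumes "f \<noteq> 0"
  shows "\<exists>m. is_lead m f"
proof -
  have ne: "lex_code ` keys f \<noteq> {}" using assms by simp
  then have "Max (lex_code ` keys f) \<in> lex_code ` keys f" by (intro Max_in) auto
  then obtain m where "m \<in> keys f" "Max (lex_code ` keys f) = lex_code m" by blast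
  then show ?thesis
    by (intro exI[of _ m]) (auto simp: is_lead_def simp flip: \<open>Max _ = _\<close>)
qed

text \<open>A Groebner basis for a position-first order: for each coordinate \<open>s\<close>,
  Dickson's lemma selects finitely many leading monomials of the \<open>s\<close>-th entries of
  homogeneous vectors in \<open>M\<close> whose earlier entries vanish. Generation is expressed
  through all submodules \<open>N\<close> containing the basis, which avoids explicit linear
  combinations.\<close>

lemma finitely_generated:
  fixes M :: "('v::finite, 'k::field) mpoly vec set"
  assumes M: "graded_submodule ds M"
  shows "\<exists>B. finite B \<and> (\<forall>(b, v)\<in>B. v \<in> M \<and> homogeneous_vec b ds v) \<and>
    (\<forall>N. submodule_vec (length ds) N \<longrightarrow> snd ` B \<subseteq> N \<longrightarrow> M \<subseteq> N)"
proof -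
  let ?r = "length ds"
  have M': "submodule_vec ?r M" using M by (simp add: graded_submodule_def)
  define good where "good = (\<lambda>s m bv. snd bv \<in> M \<and> homogeneous_vec (fst bv) ds (snd bv) \<and>
      (\<forall>j<s. snd bv $ j = 0) \<and> is_lead m (snd bv $ s))"
  define L where "L = (\<lambda>s. {m. \<exists>bv. good s m bv})"
  have "\<forall>s. \<exists>L0. finite L0 \<and> L0 \<subseteq> L s \<and> (\<forall>l\<in>L s. \<exists>l0\<in>L0. \<forall>v\<in>UNIV. lookup l0 v \<le> lookup l v)"
    by (intro allI dickson) simp
  then obtain L0 where L0: "\<And>s. finite (L0 s)" "\<And>s. L0 s \<subseteq> L s"
    "\<And>s l. l \<in> L s \<Longrightarrow> \<exists>l0\<in>L0 s. \<forall>v. lookup l0 v \<le> lookup l v"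
    by (metis UNIV_I)
  define G where "G = (\<lambda>s m. SOME bv. good s m bv)"
  have G: "good s m (G s m)" if "m \<in> L s" for s m
    using that someI_ex[of "good s m"] by (auto simp: L_def G_def)
  define B where "B = (\<Union>s<?r. G s ` L0 s)"
  have "M \<subseteq> N" if N: "submodule_vec ?r N" and BN: "snd ` B \<subseteq> N" for N
  proof (rule graded_submodule_subsetI[OF M N])
    fix b v
    assume "v \<in> M" "homogeneous_vec b ds v"
    \<comment> \<open>Outer induction on the number \<open>k\<close> of trailing coordinates that
      may be nonzero, inner induction on the leading monomial of the first of them.\<close>
    moreover have "v \<in> N" if "k \<le> ?r" "v \<in> M" "homogeneous_vec b ds v" "\<forall>j<?r - k. v $ j = 0" for k v
      using that
    proof (induction k arbitrary: v)
      case 0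
      then have "v = 0\<^sub>v ?r" by (intro eq_vecI) (auto simp: homogeneous_vec_def)
      then show ?case using submodule_vecD(2)[OF N] by simp
    next
      case (Suc k)
      define s where "s = ?r - Suc k"
      have s: "s < ?r" "?r - k = Suc s" using Suc.prems(1) by (auto simp: s_def)
      \<comment> \<open>The monomials of degree at most \<open>b\<close> that do not exceed the
        leading one. Homogeneity keeps all degrees below \<open>b\<close>, so this set is finite,
        and it shrinks whenever the leading monomial drops.\<close>
      define \<mu> where "\<mu> = (\<lambda>f :: ('v, 'k) mpoly. {m' :: 'v \<Rightarrow>\<^sub>0 nat. mon_deg m' \<le> b \<and> (\<exists>m\<in>keys f. lex_code m' \<le> lex_code m)})"
      have fin: "finite (\<mu> f)" for f
        by (rule finite_subset[OF _ finite_mon_deg_le[of b]]) (auto simp: \<mu>_def)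
      from Suc.prems(2-4) show ?case unfolding s_def[symmetric]
      proof (induction "card (\<mu> (v $ s))" arbitrary: v rule: less_induct)
        case less
        show ?case
        proof (cases "v $ s = 0")
          case True
          then show ?thesis using less.prems Suc.prems(1) s
            by (intro Suc.IH) (auto simp: less_Suc_eq)
        next
          case False
          then obtain m where m: "is_lead m (v $ s)" using ex_is_lead by blast
          with less.prems have "good s m (b, v)" by (simp add: good_def)
          then have "m \<in> L s" by (auto simp: L_def)
          then obtain m0 where m0: "m0 \<in> L0 s" "\<And>v. lookup m0 v \<le> lookup m v"
            using L0(3) by blast
          obtain b0 u where u: "G s m0 = (b0, u)" by force
          with G[of m0 s] m0(1) L0(2) have "good s m0 (b0, u)" by auto
          then have uM: "u \<in> M" and uh: "homogeneous_vec b0 ds u" and u0: "\<And>j. j < s \<Longrightarrow> u $ j = 0"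
            and ul: "is_lead m0 (u $ s)" by (auto simp: good_def)
          have "u \<in> snd ` B" using u m0(1) s(1) by (force simp: B_def)
          then have uN: "u \<in> N" using BN by blast
          have mm: "m = m0 + (m - m0)"
            by (intro poly_mapping_eqI) (simp add: lookup_add lookup_minus m0(2))
          have dim: "v \<in> carrier_vec ?r" "u \<in> carrier_vec ?r"
            using less.prems(2) uh by (auto simp: homogeneous_vec_def)
          have ulz: "lookup (u $ s) m0 \<noteq> 0"
            using ul by (auto simp: is_lead_def Poly_Mapping.in_keys_iff)
          have dm: "mon_deg m + ds ! s = b" "mon_deg m0 + ds ! s = b0"
            using less.prems(2) uh m ul s(1) by (auto simp: homogeneous_vec_def graded_maps_def is_lead_def)
          \<comment> \<open>The term that makes the leading terms of \<open>v $ s\<close> and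
            \<open>u $ s * t\<close> cancel.\<close>
          define t where "t = Poly_Mapping.single (m - m0) (lookup (v $ s) m / lookup (u $ s) m0)"
          have tg: "t \<in> graded_maps b b0"
            unfolding t_def by (rule graded_maps_single) (use dm mm mon_deg_add[of m0 "m - m0"] in simp)
          define v' where "v' = v + (- t) \<cdot>\<^sub>v u"
          have v'i: "v' $ j = v $ j - u $ j * t" if "j < ?r" for j
            using that dim by (simp add: v'_def mult.commute)
          have "v' \<in> M" unfolding v'_def
            using less.prems(1) uM by (intro submodule_vecD[OF M'])
          moreover have "homogeneous_vec b ds v'"
            unfolding homogeneous_vec_def
          proof (intro conjI allI impI)
            show "v' \<in> carrier_vec ?r" using dim by (simp add: v'_def)
          next
            fix j assume j: "j < ?r"
            have "u $ j * t \<in> graded_maps b (ds ! j)"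
              using uh j tg by (auto simp: homogeneous_vec_def intro: graded_maps_mult)
            then show "v' $ j \<in> graded_maps b (ds ! j)"
              using less.prems(2) j by (simp add: v'i homogeneous_vec_def graded_maps_minus)
          qed
          moreover have "\<forall>j<s. v' $ j = 0"
            using less.prems(3) u0 s(1) by (simp add: v'i)
          moreover have "card (\<mu> (v' $ s)) < card (\<mu> (v $ s))"
          proof (rule psubset_card_mono[OF fin])
            have less_code: "lex_code x < lex_code m" if x: "x \<in> keys (v' $ s)" for x
            proof -
              have "lookup (v' $ s) m = lookup (v $ s) m - lookup (u $ s * t) (m0 + (m - m0))"
                using v'i[OF s(1)] mm by (simp add: lookup_minus)
              also have "\<dots> = 0"
                unfolding t_def lookup_times_single_add using ulz by simp
              finally have "x \<noteq> m" using x by (auto simp: Poly_Mapping.in_keys_iff)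
              then have ne: "lex_code x \<noteq> lex_code m" using inj_lex_code by (auto dest: injD)
              from x consider "x \<in> keys (v $ s)" | "x \<in> keys (u $ s * t)"
                using v'i[OF s(1)] by (auto dest: keys_minusE)
              then have "lex_code x \<le> lex_code m"
              proof cases
                case 1
                then show ?thesis using m by (auto simp: is_lead_def)
              next
                case 2
                then obtain y where "y \<in> keys (u $ s)" "x = y + (m - m0)"
                  unfolding t_def by (rule keys_times_single)
                then have "lex_code x \<le> lex_code m0 + lex_code (m - m0)"
                  using ul by (simp add: lex_code_add is_lead_def)
                also have "\<dots> = lex_code m" using mm by (metis lex_code_add)
                finally show ?thesis .
              qed
              with ne show ?thesis by simp
            qed
            have "m \<in> \<mu> (v $ s)" using m dm by (auto simp: \<mu>_def is_lead_def)
            moreover have "m \<notin> \<mu> (v' $ s)" using less_code by (auto simp: \<mu>_def not_le)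
            moreover have "\<mu> (v' $ s) \<subseteq> \<mu> (v $ s)"
            proof
              fix x assume "x \<in> \<mu> (v' $ s)"
              then obtain y where "mon_deg x \<le> b" "y \<in> keys (v' $ s)" "lex_code x \<le> lex_code y"
                by (auto simp: \<mu>_def)
              moreover from this less_code[of y] have "lex_code x \<le> lex_code m" by simp
              ultimately show "x \<in> \<mu> (v $ s)" using m by (auto simp: \<mu>_def is_lead_def)
            qed
            ultimately show "\<mu> (v' $ s) \<subset> \<mu> (v $ s)" by blast
          qed
          ultimately have "v' \<in> N" using less.hyps by blast
          then have "v' + t \<cdot>\<^sub>v u \<in> N" using uN by (intro submodule_vecD[OF N])
          also have "v' + t \<cdot>\<^sub>v u = v"
            using dim by (intro eq_vecI) (auto simp: v'_def)
          finally show ?thesis .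
        qed
      qed
    qed
    from this[of ?r v] calculation show "v \<in> N" by simp
  qed
  moreover have "v \<in> M \<and> homogeneous_vec b ds v" if "(b, v) \<in> B" for b v
  proof -
    from that obtain s m where "m \<in> L0 s" "G s m = (b, v)" by (auto simp: B_def)
    with G[of m s] L0(2)[of s] show ?thesis by (auto simp: good_def)
  qed
  moreover have "finite B" by (simp add: B_def L0(1))
  ultimately show ?thesis by (intro exI[of _ B]) auto
qed

lemma graded_mat_vec_part:
  fixes A :: "('v::finite, 'k::comm_ring_1) mpoly mat"
  assumes A: "graded_mat ds es A" and w: "w \<in> carrier_vec (length es)"
  shows "A *\<^sub>v vec_part b es w = vec_part b ds (A *\<^sub>v w)"
proof (rule eq_vecI)
  fix r assume "r < dim_vec (vec_part b ds (A *\<^sub>v w))"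
  then have r: "r < length ds" by (simp add: vec_part_def)
  have "(A *\<^sub>v vec_part b es w) $ r = (\<Sum>s<length es. A $$ (r, s) * graded_part b (es ! s) (w $ s))"
    using A r by (auto simp: graded_mat_def scalar_prod_def vec_part_def lessThan_atLeast0)
  also have "\<dots> = (\<Sum>s<length es. graded_part b (ds ! r) (A $$ (r, s) * w $ s))"
    using A r by (intro sum.cong) (auto simp: graded_mat_def intro!: graded_part_mult[symmetric])
  also have "\<dots> = graded_part b (ds ! r) ((A *\<^sub>v w) $ r)"
    using A r w by (auto simp: graded_mat_def scalar_prod_def lessThan_atLeast0 graded_part_sum)
  finally show "(A *\<^sub>v vec_part b es w) $ r = vec_part b ds (A *\<^sub>v w) $ r"
    using r by (simp add: vec_part_def)
qed (use A in \<open>auto simp: graded_mat_def vec_part_def\<close>)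

lemma graded_submodule_kernel:
  fixes A :: "('v::finite, 'k::comm_ring_1) mpoly mat"
  assumes A: "graded_mat ds es A"
  shows "graded_submodule es (mat_kernel A)"
proof -
  have c: "A \<in> carrier_mat (length ds) (length es)" using A by (simp add: graded_mat_def)
  have "vec_part b es w \<in> mat_kernel A" if "w \<in> mat_kernel A" for b w
  proof (rule mat_kernelI[OF c])
    have "vec_part b ds (0\<^sub>v (length ds)) = 0\<^sub>v (length ds)"
      by (intro eq_vecI) (auto simp: vec_part_def)
    then show "A *\<^sub>v vec_part b es w = 0\<^sub>v (length ds)"
      using graded_mat_vec_part[OF A] mat_kernelD[OF c that] by simp
  qed (simp add: vec_part_def)
  then show ?thesis using submodule_vec_kernel[OF c] by (simp add: graded_submodule_def)
qed

lemma minimal_free_cover: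
  fixes M :: "('v::finite, 'k::field) mpoly vec set"
  assumes M: "graded_submodule ds M"
  shows "\<exists>es A. graded_mat ds es A \<and> (\<lambda>w. A *\<^sub>v w) ` carrier_vec (length es) = M \<and>
    (\<forall>w\<in>mat_kernel A. \<forall>s<length es. w $ s \<in> irrelevant_ideal)"
proof -
  let ?r = "length ds"
  define gens where "gens = (\<lambda>B. finite B \<and> (\<forall>(b, v)\<in>B. v \<in> M \<and> homogeneous_vec b ds v) \<and>
    (\<forall>N. submodule_vec ?r N \<longrightarrow> snd ` B \<subseteq> N \<longrightarrow> M \<subseteq> N))"
  obtain B0 where "gens B0" unfolding gens_def using finitely_generated[OF M] by blast
  define B where "B = arg_min card gens"
  have B: "gens B" unfolding B_def by (rule arg_min_natI) fact
  note B' = B[unfolded gens_def]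
  note Bfin = conjunct1[OF B']
  have Bin: "v \<in> M" "homogeneous_vec b ds v" if "(b, v) \<in> B" for b v
    using bspec[OF conjunct1[OF conjunct2[OF B']] that] by auto
  have Bgen: "M \<subseteq> N" if "submodule_vec ?r N" "snd ` B \<subseteq> N" for N
    using conjunct2[OF conjunct2[OF B'], rule_format, OF that] .
  have min: "\<not> gens B'" if "card B' < card B" for B'
    using arg_min_nat_le[of gens B' card] that by (metis B_def not_le)
  obtain ps where ps: "set ps = B" "distinct ps"
    using finite_distinct_list[OF Bfin] by metis
  define es where "es = map fst ps"
  define A where "A = mat ?r (length es) (\<lambda>(r, s). snd (ps ! s) $ r)"
  have len: "length es = length ps" by (simp add: es_def)
  have c: "A \<in> carrier_mat ?r (length es)" by (simp add: A_def)
  have ps_in: "snd (ps ! s) \<in> M" "homogeneous_vec (es ! s) ds (snd (ps ! s))" if "s < length es" for s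
  proof -
    have "ps ! s \<in> B" using that ps(1) by (auto simp: es_def)
    then have "(fst (ps ! s), snd (ps ! s)) \<in> B" by simp
    from Bin[OF this] show "snd (ps ! s) \<in> M" "homogeneous_vec (es ! s) ds (snd (ps ! s))"
      using that by (simp_all add: es_def)
  qed
  have col: "col A s = snd (ps ! s)" if "s < length es" for s
    using ps_in(2)[OF that] that by (intro eq_vecI) (auto simp: A_def homogeneous_vec_def)
  have A: "graded_mat ds es A"
    using ps_in(2) by (auto simp: graded_mat_def A_def homogeneous_vec_def)
  have M': "submodule_vec ?r M" using M by (simp add: graded_submodule_def)
  have "(\<lambda>w. A *\<^sub>v w) ` carrier_vec (length es) \<subseteq> M"
  proof clarify
    fix w :: "('v, 'k) mpoly vec" assume "w \<in> carrier_vec (length es)"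
    then show "A *\<^sub>v w \<in> M"
      using ps_in(1) by (intro submodule_vec_mult_mat_vec[OF M' c]) (auto simp: col submodule_vecD[OF M'])
  qed
  moreover have "M \<subseteq> (\<lambda>w. A *\<^sub>v w) ` carrier_vec (length es)"
  proof -
    have "snd ` B \<subseteq> (\<lambda>w. A *\<^sub>v w) ` carrier_vec (length es)"
    proof clarify
      fix b v assume "(b, v) \<in> B"
      then obtain s where s: "s < length es" "ps ! s = (b, v)"
        using ps(1) len by (metis in_set_conv_nth)
      have "A *\<^sub>v unit_vec (length es) s = col A s"
        using c s(1) by (intro eq_vecI) auto
      then show "snd (b, v) \<in> (\<lambda>w. A *\<^sub>v w) ` carrier_vec (length es)"
        using s col by (intro image_eqI[of _ _ "unit_vec (length es) s"]) auto
    qed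
    then show ?thesis using Bgen[OF submodule_vec_image[OF c]] by blast
  qed
  moreover have "w $ i \<in> irrelevant_ideal" if w: "w \<in> mat_kernel A" and i: "i < length es" for w i
  proof (rule ccontr)
    define c0 where "c0 = lookup (w $ i) 0"
    assume "w $ i \<notin> irrelevant_ideal"
    then have c0: "c0 \<noteq> 0" by (simp add: irrelevant_ideal_def c0_def)
    \<comment> \<open>In this degree the \<open>i\<close>-th entry of the syzygy is exactly the
      constant \<open>c0\<close>, hence a unit, and not merely a polynomial with that constant
      term.\<close>
    define u where "u = vec_part (es ! i) es w"
    have "u \<in> mat_kernel A"
      using graded_submodule_kernel[OF A] w by (auto simp: graded_submodule_def u_def)
    then have u: "u \<in> carrier_vec (length es)" "A *\<^sub>v u = 0\<^sub>v ?r"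
      using mat_kernelD[OF c] by blast+
    have ui: "u $ i = Poly_Mapping.single 0 c0"
    proof (rule poly_mapping_eqI)
      fix m
      show "lookup (u $ i) m = lookup (Poly_Mapping.single 0 c0) m"
        using i by (auto simp: u_def vec_part_def lookup_graded_part lookup_single when_def mon_deg_eq_0_iff c0_def)
    qed
    have "gens (B - {ps ! i})"
      unfolding gens_def
    proof (intro conjI allI impI)
      fix N assume N: "submodule_vec ?r N" and sub: "snd ` (B - {ps ! i}) \<subseteq> N"
      \<comment> \<open>With the \<open>i\<close>-th entry erased, the matrix uses only the other
        columns but still produces a unit multiple of column \<open>i\<close>.\<close>
      let ?u = "u - u $ i \<cdot>\<^sub>v unit_vec (length es) i"
      have "A *\<^sub>v ?u \<in> N"
      proof (rule submodule_vec_mult_mat_vec[OF N c])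
        fix s assume s: "s < length es"
        show "?u $ s \<cdot>\<^sub>v col A s \<in> N"
        proof (cases "s = i")
          case True
          then have "?u $ s \<cdot>\<^sub>v col A s = 0\<^sub>v ?r" using u(1) i c by (intro eq_vecI) auto
          then show ?thesis using submodule_vecD(2)[OF N] by simp
        next
          case False
          then have "ps ! s \<in> B - {ps ! i}"
            using s i ps len by (auto simp: nth_eq_iff_index_eq)
          then show ?thesis using sub by (auto simp: col[OF s] intro: submodule_vecD[OF N])
        qed
      qed (use u in auto)
      also have "A *\<^sub>v ?u = - (u $ i \<cdot>\<^sub>v col A i)"
      proof -
        have "A *\<^sub>v ?u = A *\<^sub>v u - A *\<^sub>v (u $ i \<cdot>\<^sub>v unit_vec (length es) i)"
          using c u(1) by (intro mult_minus_distrib_mat_vec) auto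
        also have "A *\<^sub>v (u $ i \<cdot>\<^sub>v unit_vec (length es) i) = u $ i \<cdot>\<^sub>v col A i"
          using c i by (subst mult_mat_smult_vec[OF c]) (auto intro!: eq_vecI)
        finally show ?thesis using u(2) c by (auto intro!: eq_vecI)
      qed
      finally have *: "- (u $ i \<cdot>\<^sub>v col A i) \<in> N" .
      have "Poly_Mapping.single 0 (- inverse c0) \<cdot>\<^sub>v (- (u $ i \<cdot>\<^sub>v col A i)) \<in> N"
        by (rule submodule_vecD(4)[OF N *])
      also have "Poly_Mapping.single 0 (- inverse c0) \<cdot>\<^sub>v (- (u $ i \<cdot>\<^sub>v col A i)) = col A i"
      proof (rule eq_vecI)
        fix j assume "j < dim_vec (col A i)"
        moreover have "Poly_Mapping.single 0 (- inverse c0) * (- (Poly_Mapping.single 0 c0 * x)) = x"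
          for x :: "('v, 'k) mpoly"
          using c0 by (simp add: single_uminus mult.assoc[symmetric] mult_single)
        ultimately show "(Poly_Mapping.single 0 (- inverse c0) \<cdot>\<^sub>v (- (u $ i \<cdot>\<^sub>v col A i))) $ j = col A i $ j"
          by (simp add: ui)
      qed simp
      finally have "snd (ps ! i) \<in> N" using col[OF i] by simp
      with sub have "snd ` B \<subseteq> N" by blast
      then show "M \<subseteq> N" by (rule Bgen[OF N])
    qed (use Bfin Bin in auto)
    moreover have "card (B - {ps ! i}) < card B"
      using Bfin ps i len by (intro card_Diff1_less) auto
    ultimately show False using min by blast
  qed
  ultimately show ?thesis using A by blast
qed

theorem minimal_resolution_exists:
  fixes I :: "('v::finite, 'k::field) mpoly set"
  assumes I: "0 \<in> I" "\<And>f g. f \<in> I \<Longrightarrow> g \<in> I \<Longrightarrow> f + g \<in> I" "\<And>f g. f \<in> I \<Longrightarrow> g * f \<in> I"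
    and graded: "\<And>f b. f \<in> I \<Longrightarrow> graded_part b 0 f \<in> I"
    and sub: "I \<subseteq> irrelevant_ideal"
  shows "\<exists>F. minimal_graded_free_resolution F I"
proof -
  define P where "P = (\<lambda>(ds, M :: ('v, 'k) mpoly vec set) (es, A). graded_mat ds es A \<and>
    (\<lambda>w. A *\<^sub>v w) ` carrier_vec (length es) = M \<and>
    (\<forall>w\<in>mat_kernel A. \<forall>s<length es. w $ s \<in> irrelevant_ideal))"
  define cover where "cover = (\<lambda>st. SOME c. P st c)"
  have cover: "P (ds, M) (cover (ds, M))" if "graded_submodule ds M" for ds M
  proof -
    have "\<exists>c. P (ds, M) c" using minimal_free_cover[OF that] by (auto simp: P_def)
    then show ?thesis unfolding cover_def by (rule someI_ex)
  qed
  define M0 where "M0 = {v \<in> carrier_vec 1. v $ 0 \<in> I}"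
  \<comment> \<open>A state consists of the degrees of \<open>F_i\<close> and the submodule of
    \<open>F_i\<close> still to be covered: first \<open>I\<close> inside R, afterwards the kernel
    of the cover just chosen.\<close>
  define st where "st = rec_nat ([0], M0) (\<lambda>_ s. (fst (cover s), mat_kernel (snd (cover s))))"
  have st_0: "st 0 = ([0], M0)" and st_Suc: "\<And>i. st (Suc i) = (fst (cover (st i)), mat_kernel (snd (cover (st i))))"
    by (simp_all add: st_def)
  have "graded_submodule [0] M0"
    unfolding graded_submodule_def submodule_vec_def
    using I graded by (auto simp: M0_def vec_part_def)
  then have gr: "graded_submodule (fst (st i)) (snd (st i))" for i
  proof (induction i)
    case (Suc i)
    have "P (st i) (cover (st i))" using cover[OF Suc.IH[OF Suc.prems]] by simp
    then have "graded_mat (fst (st i)) (fst (cover (st i))) (snd (cover (st i)))"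
      by (auto simp: P_def split: prod.splits)
    then show ?case by (simp add: st_Suc graded_submodule_kernel)
  qed (simp add: st_0)
  define F :: "('v, 'k) free_complex" where
    "F = \<lparr>degs = (\<lambda>i. fst (st i)), diff = (\<lambda>i. snd (cover (st i))), aug = vec 1 (\<lambda>_. 1)\<rparr>"
  have P: "graded_mat (degs F i) (degs F (Suc i)) (diff F i)"
    "diff_image F i = snd (st i)"
    "\<And>w s. w \<in> mat_kernel (diff F i) \<Longrightarrow> s < rk F (Suc i) \<Longrightarrow> w $ s \<in> irrelevant_ideal" for i
  proof -
    have "P (st i) (cover (st i))" using cover[of "fst (st i)" "snd (st i)"] gr by simp
    then have *: "graded_mat (fst (st i)) (fst (cover (st i))) (snd (cover (st i)))"
      "(\<lambda>w. snd (cover (st i)) *\<^sub>v w) ` carrier_vec (length (fst (cover (st i)))) = snd (st i)"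
      "\<forall>w\<in>mat_kernel (snd (cover (st i))). \<forall>s<length (fst (cover (st i))). w $ s \<in> irrelevant_ideal"
      by (auto simp: P_def split: prod.splits)
    from * show "graded_mat (degs F i) (degs F (Suc i)) (diff F i)" "diff_image F i = snd (st i)"
      by (simp_all add: F_def st_Suc diff_image_def rk_def)
    show "w $ s \<in> irrelevant_ideal" if "w \<in> mat_kernel (diff F i)" "s < rk F (Suc i)" for w s
      using * that by (auto simp: F_def st_Suc rk_def)
  qed
  have carr: "diff F i \<in> carrier_mat (rk F i) (rk F (Suc i))" for i
    using P(1)[of i] by (simp add: graded_mat_def rk_def)
  have rk0: "rk F 0 = 1" by (simp add: F_def rk_def st_0)
  have aug: "aug F \<bullet> v = v $ 0" if "v \<in> carrier_vec 1" for v
    using that by (simp add: F_def scalar_prod_def)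
  have exact: "mat_kernel (diff F i) = diff_image F (Suc i)" for i
    unfolding P(2) by (simp add: st_Suc F_def)
  \<comment> \<open>Columns of \<open>diff F i\<close> lie in its image. That image is
    \<open>I\<close> for \<open>i = 0\<close> and the kernel of the preceding minimal cover
    otherwise; both have entries without constant term.\<close>
  have "elements_mat (diff F i) \<subseteq> irrelevant_ideal" for i
  proof
    fix x assume "x \<in> elements_mat (diff F i)"
    then obtain r s where rs: "r < rk F i" "s < rk F (Suc i)" "x = diff F i $$ (r, s)"
      using carr[of i] by auto
    have "col (diff F i) s = diff F i *\<^sub>v unit_vec (rk F (Suc i)) s"
      using carr[of i] rs by (intro eq_vecI) auto
    then have "col (diff F i) s \<in> diff_image F i" by (auto simp: diff_image_def)
    moreover have x: "x = col (diff F i) s $ r" using rs carr[of i] by auto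
    ultimately show "x \<in> irrelevant_ideal"
    proof (cases i)
      case 0
      with \<open>col (diff F i) s \<in> diff_image F i\<close> x rs show ?thesis
        using sub by (auto simp: P(2) st_0 M0_def rk0)
    next
      case (Suc k)
      with \<open>col (diff F i) s \<in> diff_image F i\<close> have "col (diff F i) s \<in> mat_kernel (diff F k)"
        by (simp add: exact)
      with P(3)[of _ k r] x rs Suc show ?thesis by simp
    qed
  qed
  moreover have "graded_free_resolution F I"
    unfolding graded_free_resolution_def
  proof (intro conjI allI)
    show "graded_maps_ok F"
      using P(1) rk0 unfolding graded_maps_ok_def graded_mat_def rk_def[symmetric]
      by (auto simp: F_def st_0 graded_maps_def carr)
  next
    fix g :: "('v, 'k) mpoly"
    show "\<exists>v\<in>carrier_vec (rk F 0). aug F \<bullet> v - g \<in> I"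
      using I(1) by (intro bexI[of _ "vec 1 (\<lambda>_. g)"]) (auto simp: aug rk0)
  next
    show "{v \<in> carrier_vec (rk F 0). aug F \<bullet> v \<in> I} = diff_image F 0"
      by (auto simp: P(2) st_0 M0_def rk0 aug)
  qed (rule exact)
  ultimately show ?thesis unfolding minimal_graded_free_resolution_def by blast
qed

section \<open>Minimal resolutions are finite\<close>

text \<open>The ideal generated by the variables in \<open>S\<close>. Membership is tested monomial
  by monomial, so regularity of a further variable can be read off the exponents.\<close>

definition monomial_prime :: "'v set \<Rightarrow> ('v, 'k::comm_ring_1) mpoly set" where
  "monomial_prime S = {f. \<forall>m\<in>keys f. \<exists>v\<in>S. lookup m v \<noteq> 0}"

lemma monomial_prime_0 [simp]: "0 \<in> monomial_prime S"
  by (simp add: monomial_prime_def)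

lemma monomial_prime_add:
  "f \<in> monomial_prime S \<Longrightarrow> g \<in> monomial_prime S \<Longrightarrow> f + g \<in> monomial_prime S"
  by (auto simp: monomial_prime_def dest!: keys_addE)

lemma monomial_prime_mult: "f \<in> monomial_prime S \<Longrightarrow> g * f \<in> monomial_prime S"
  unfolding monomial_prime_def
proof (clarify elim!: keys_multE)
  fix a b assume "\<forall>m\<in>keys f. \<exists>v\<in>S. lookup m v \<noteq> 0" "b \<in> keys f"
  then obtain v where "v \<in> S" "lookup b v \<noteq> 0" by blast
  then show "\<exists>v\<in>S. lookup (a + b) v \<noteq> 0"
    by (intro bexI[of _ v]) (simp_all add: lookup_add)
qed

lemma monomial_prime_uminus: "f \<in> monomial_prime S \<Longrightarrow> - f \<in> monomial_prime S"
  using monomial_prime_mult[of f S "- 1"] by simp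

lemma monomial_prime_sum:
  "(\<And>x. x \<in> A \<Longrightarrow> f x \<in> monomial_prime S) \<Longrightarrow> sum f A \<in> monomial_prime S"
  by (induction A rule: infinite_finite_induct) (auto intro: monomial_prime_add)

lemma monomial_prime_mono: "S \<subseteq> T \<Longrightarrow> monomial_prime S \<subseteq> monomial_prime T"
  by (fastforce simp: monomial_prime_def)

lemma monomial_prime_empty: "monomial_prime {} = {0}"
  by (auto simp: monomial_prime_def)

lemma monomial_prime_UNIV: "monomial_prime UNIV = irrelevant_ideal"
proof -
  have "(\<exists>v. lookup m v \<noteq> 0) \<longleftrightarrow> m \<noteq> 0" for m :: "'a \<Rightarrow>\<^sub>0 nat"
    by (metis lookup_zero poly_mapping_eqI)
  then show ?thesis
    by (auto simp: monomial_prime_def irrelevant_ideal_def Poly_Mapping.in_keys_iff)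
qed

lemma var_in_monomial_prime: "v \<in> S \<Longrightarrow> var v \<in> monomial_prime S"
  by (auto simp: monomial_prime_def var_def lookup_single when_def)

lemma monomial_prime_insert_decomp:
  fixes f :: "('v, 'k::comm_ring_1) mpoly"
  assumes "f \<in> monomial_prime (insert v S)"
  shows "\<exists>g\<in>monomial_prime S. \<exists>h. f = g + var v * h"
proof (induction f rule: poly_mapping_additive_induct)
  case zero
  show ?case by (intro bexI[of _ 0] exI[of _ 0]) auto
next
  case (add f g)
  then obtain a b c d where "a \<in> monomial_prime S" "f = a + var v * b"
    and "c \<in> monomial_prime S" "g = c + var v * d" by blast
  then show ?case
    by (intro bexI[of _ "a + c"] exI[of _ "b + d"]) (auto simp: algebra_simps monomial_prime_add)
next
  case (single m c)
  show ?case
  proof (cases "\<exists>w\<in>S. lookup m w \<noteq> 0")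
    case True
    then have "Poly_Mapping.single m c \<in> monomial_prime S"
      by (auto simp: monomial_prime_def split: if_splits)
    then show ?thesis by (intro bexI[of _ "Poly_Mapping.single m c"] exI[of _ 0]) auto
  next
    case False
    with assms single have "lookup m v \<noteq> 0" by (auto simp: monomial_prime_def)
    then have "m = Poly_Mapping.single v 1 + (m - Poly_Mapping.single v 1)"
      by (intro poly_mapping_eqI) (auto simp: lookup_add lookup_minus lookup_single when_def)
    then have "Poly_Mapping.single m c = var v * Poly_Mapping.single (m - Poly_Mapping.single v 1) c"
      by (simp add: var_def mult_single)
    then show ?thesis by (intro bexI[of _ 0]) auto
  qed
qed

lemma monomial_prime_regular:
  fixes w :: "('v, 'k::comm_ring_1) mpoly"
  assumes "var v * w \<in> monomial_prime S" "v \<notin> S"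
  shows "w \<in> monomial_prime S"
  unfolding monomial_prime_def
proof (clarify)
  fix m assume "m \<in> keys w"
  then have "lookup (w * var v) (m + Poly_Mapping.single v 1) \<noteq> 0"
    by (simp add: var_def lookup_times_single_add Poly_Mapping.in_keys_iff)
  then have "m + Poly_Mapping.single v 1 \<in> keys (var v * w)"
    by (simp add: Poly_Mapping.in_keys_iff mult.commute)
  with assms(1) obtain u where "u \<in> S" "lookup (m + Poly_Mapping.single v 1) u \<noteq> 0"
    by (auto simp: monomial_prime_def)
  moreover then have "u \<noteq> v" using assms(2) by auto
  ultimately show "\<exists>u\<in>S. lookup m u \<noteq> 0"
    by (auto simp: lookup_add lookup_single when_def)
qed

section \<open>Exactness of a resolution modulo variables\<close>

definition mat_app :: "nat \<Rightarrow> (nat \<Rightarrow> nat \<Rightarrow> 'a) \<Rightarrow> (nat \<Rightarrow> 'a) \<Rightarrow> nat \<Rightarrow> 'a::comm_ring_1" where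
  "mat_app r D v t = (\<Sum>s<r. D t s * v s)"

lemma mat_app_add: "mat_app r D (\<lambda>s. v s + w s) t = mat_app r D v t + mat_app r D w t"
  by (simp add: mat_app_def algebra_simps sum.distrib)

lemma mat_app_diff: "mat_app r D (\<lambda>s. v s - w s) t = mat_app r D v t - mat_app r D w t"
  by (simp add: mat_app_def algebra_simps sum_subtractf)

lemma mat_app_mult: "mat_app r D (\<lambda>s. c * v s) t = c * mat_app r D v t"
  by (simp add: mat_app_def sum_distrib_left algebra_simps)

lemma mat_app_cong: "(\<And>s. s < r \<Longrightarrow> v s = w s) \<Longrightarrow> mat_app r D v t = mat_app r D w t"
  by (simp add: mat_app_def)

text \<open>The variables in \<open>S\<close> form a regular sequence, and dividing out one of its
  members preserves exactness except at the last place; so after \<open>card S\<close> steps exactness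
  still holds from place \<open>card S\<close> on.\<close>

lemma exact_mod_monomial_prime:
  fixes D :: "nat \<Rightarrow> nat \<Rightarrow> nat \<Rightarrow> ('v, 'k::comm_ring_1) mpoly"
  assumes "finite S"
    and complex: "\<And>i v t. t < r i \<Longrightarrow> mat_app (r (Suc i)) (D i) (mat_app (r (Suc (Suc i))) (D (Suc i)) v) t = 0"
    and exact: "\<And>i v. (\<And>t. t < r i \<Longrightarrow> mat_app (r (Suc i)) (D i) v t = 0) \<Longrightarrow>
      \<exists>w. \<forall>s<r (Suc i). v s = mat_app (r (Suc (Suc i))) (D (Suc i)) w s"
    and "card S \<le> i"
    and "\<And>t. t < r i \<Longrightarrow> mat_app (r (Suc i)) (D i) v t \<in> monomial_prime S"
  shows "\<exists>w. \<forall>s<r (Suc i). v s - mat_app (r (Suc (Suc i))) (D (Suc i)) w s \<in> monomial_prime S"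
  using assms(1,4,5)
proof (induction S arbitrary: i v rule: finite_induct)
  case empty
  then show ?case using exact[of i v] by (auto simp: monomial_prime_empty)
next
  case (insert x S)
  then obtain k where i: "i = Suc k" "card S \<le> k" by (cases i) auto
  have "\<forall>t. \<exists>j w. t < r i \<longrightarrow> j \<in> monomial_prime S \<and> mat_app (r (Suc i)) (D i) v t = j + var x * w"
    using monomial_prime_insert_decomp insert.prems(2) by metis
  then obtain j w where jw: "\<And>t. t < r i \<Longrightarrow> j t \<in> monomial_prime S"
    "\<And>t. t < r i \<Longrightarrow> mat_app (r (Suc i)) (D i) v t = j t + var x * w t"
    by metis
  have "mat_app (r i) (D k) w t \<in> monomial_prime S" if "t < r k" for t
  proof -
    \<comment> \<open>Applying the previous differential shows that \<open>w\<close> is a cycle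
      modulo \<open>S\<close>, after cancelling \<open>x\<close>. This needs a place
      \<open>k\<close> before \<open>i\<close>, so each variable costs one place of
      exactness.\<close>
    have "0 = mat_app (r i) (D k) (mat_app (r (Suc i)) (D i) v) t"
      using complex[OF that, of v] i by simp
    also have "\<dots> = mat_app (r i) (D k) (\<lambda>t. j t + var x * w t) t"
      by (intro mat_app_cong) (simp add: jw)
    also have "\<dots> = mat_app (r i) (D k) j t + var x * mat_app (r i) (D k) w t"
      by (simp add: mat_app_add mat_app_mult)
    finally have "var x * mat_app (r i) (D k) w t = - mat_app (r i) (D k) j t"
      by (simp add: eq_neg_iff_add_eq_0 add.commute)
    moreover have "mat_app (r i) (D k) j t \<in> monomial_prime S"
      unfolding mat_app_def by (intro monomial_prime_sum monomial_prime_mult jw) auto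
    ultimately show ?thesis
      using monomial_prime_regular insert.hyps(2) monomial_prime_uminus by metis
  qed
  then obtain u where u: "\<And>s. s < r i \<Longrightarrow> w s - mat_app (r (Suc i)) (D i) u s \<in> monomial_prime S"
    using insert.IH[of k w] i by auto
  have "mat_app (r (Suc i)) (D i) (\<lambda>s. v s - var x * u s) t \<in> monomial_prime S" if "t < r i" for t
  proof -
    have "mat_app (r (Suc i)) (D i) (\<lambda>s. v s - var x * u s) t =
        j t + var x * (w t - mat_app (r (Suc i)) (D i) u t)"
      by (simp add: mat_app_diff mat_app_mult jw(2)[OF that] algebra_simps)
    then show ?thesis
      using jw(1)[OF that] u[OF that] by (simp add: monomial_prime_add monomial_prime_mult)
  qed
  then obtain y where y: "\<And>s. s < r (Suc i) \<Longrightarrow>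
      v s - var x * u s - mat_app (r (Suc (Suc i))) (D (Suc i)) y s \<in> monomial_prime S"
    using insert.IH[of i "\<lambda>s. v s - var x * u s"] i by auto
  show ?case
  proof (intro exI allI impI)
    fix s assume "s < r (Suc i)"
    then have "v s - var x * u s - mat_app (r (Suc (Suc i))) (D (Suc i)) y s
        \<in> monomial_prime (insert x S)"
      using y monomial_prime_mono[of S "insert x S"] by blast
    moreover have "u s * var x \<in> monomial_prime (insert x S)"
      by (intro monomial_prime_mult var_in_monomial_prime) simp
    ultimately have "v s - var x * u s - mat_app (r (Suc (Suc i))) (D (Suc i)) y s + u s * var x
        \<in> monomial_prime (insert x S)"
      by (rule monomial_prime_add)
    then show "v s - mat_app (r (Suc (Suc i))) (D (Suc i)) y s \<in> monomial_prime (insert x S)"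
      by (simp add: algebra_simps)
  qed
qed

lemma mat_app_mult_mat_vec:
  assumes "A \<in> carrier_mat n r" "v \<in> carrier_vec r" "t < n"
  shows "(A *\<^sub>v v) $ t = mat_app r (\<lambda>t s. A $$ (t, s)) (($) v) t"
  using assms by (simp add: mat_app_def scalar_prod_def lessThan_atLeast0)

lemma resolution_carrier:
  assumes "graded_free_resolution F I"
  shows "diff F i \<in> carrier_mat (rk F i) (rk F (Suc i))"
  using assms by (simp add: graded_free_resolution_def graded_maps_ok_def)

lemma resolution_exact:
  assumes F: "graded_free_resolution F I"
    and v: "v \<in> carrier_vec (rk F (Suc i))" "diff F i *\<^sub>v v = 0\<^sub>v (rk F i)"
  obtains w where "w \<in> carrier_vec (rk F (Suc (Suc i)))" "v = diff F (Suc i) *\<^sub>v w"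
proof -
  have "v \<in> mat_kernel (diff F i)"
    using v resolution_carrier[OF F] by (intro mat_kernelI) auto
  also have "mat_kernel (diff F i) = diff_image F (Suc i)"
    using F by (simp add: graded_free_resolution_def)
  finally show thesis using that by (auto simp: diff_image_def)
qed

lemma resolution_complex:
  assumes F: "graded_free_resolution F I"
    and w: "w \<in> carrier_vec (rk F (Suc (Suc i)))"
  shows "diff F i *\<^sub>v (diff F (Suc i) *\<^sub>v w) = 0\<^sub>v (rk F i)"
proof -
  have "diff F (Suc i) *\<^sub>v w \<in> diff_image F (Suc i)"
    using w by (auto simp: diff_image_def)
  also have "diff_image F (Suc i) = mat_kernel (diff F i)"
    using F by (simp add: graded_free_resolution_def)
  finally show ?thesis using mat_kernelD[OF resolution_carrier[OF F]] by blast
qed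

definition diff_fun :: "('v, 'k::comm_ring_1) free_complex \<Rightarrow> nat \<Rightarrow> nat \<Rightarrow> nat \<Rightarrow> ('v, 'k) mpoly" where
  "diff_fun F i t s = diff F i $$ (t, s)"

lemma mat_app_diff_fun:
  assumes "graded_free_resolution F I" "t < rk F i"
  shows "mat_app (rk F (Suc i)) (diff_fun F i) v t = (diff F i *\<^sub>v vec (rk F (Suc i)) v) $ t"
proof -
  have "(diff F i *\<^sub>v vec (rk F (Suc i)) v) $ t =
      mat_app (rk F (Suc i)) (\<lambda>t s. diff F i $$ (t, s)) (($) (vec (rk F (Suc i)) v)) t"
    using resolution_carrier[OF assms(1), of i] assms(2) by (intro mat_app_mult_mat_vec) auto
  also have "\<dots> = mat_app (rk F (Suc i)) (diff_fun F i) v t"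
    by (simp add: mat_app_def diff_fun_def)
  finally show ?thesis ..
qed

lemma diff_fun_complex:
  assumes F: "graded_free_resolution F I" and t: "t < rk F i"
  shows "mat_app (rk F (Suc i)) (diff_fun F i) (mat_app (rk F (Suc (Suc i))) (diff_fun F (Suc i)) v) t = 0"
proof -
  let ?v = "vec (rk F (Suc (Suc i))) v"
  have "vec (rk F (Suc i)) (mat_app (rk F (Suc (Suc i))) (diff_fun F (Suc i)) v) = diff F (Suc i) *\<^sub>v ?v"
    using resolution_carrier[OF F, of "Suc i"] by (intro eq_vecI) (auto simp: mat_app_diff_fun[OF F])
  then show ?thesis
    using t by (simp add: mat_app_diff_fun[OF F] resolution_complex[OF F])
qed

lemma vec_vec_index: "v \<in> carrier_vec n \<Longrightarrow> vec n (($) v) = v"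
  by (intro eq_vecI) auto

lemma diff_fun_exact:
  assumes F: "graded_free_resolution F I"
    and v: "\<And>t. t < rk F i \<Longrightarrow> mat_app (rk F (Suc i)) (diff_fun F i) v t = 0"
  shows "\<exists>w. \<forall>s<rk F (Suc i). v s = mat_app (rk F (Suc (Suc i))) (diff_fun F (Suc i)) w s"
proof -
  let ?v = "vec (rk F (Suc i)) v"
  have "diff F i *\<^sub>v ?v = 0\<^sub>v (rk F i)"
    using resolution_carrier[OF F, of i] v by (intro eq_vecI) (auto simp: mat_app_diff_fun[OF F])
  then obtain w where w: "w \<in> carrier_vec (rk F (Suc (Suc i)))" "?v = diff F (Suc i) *\<^sub>v w"
    using resolution_exact[OF F, of ?v i] by auto
  have "vec (rk F (Suc (Suc i))) (($) w) = w" by (rule vec_vec_index[OF w(1)])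
  then have "v s = mat_app (rk F (Suc (Suc i))) (diff_fun F (Suc i)) (($) w) s" if "s < rk F (Suc i)" for s
    using that by (simp add: mat_app_diff_fun[OF F] flip: w(2))
  then show ?thesis by blast
qed

text \<open>Modulo all variables the differentials of a minimal resolution vanish, while exactness
  persists from the place that equals the number of variables. A basis vector of the next module
  would then be a cycle but not a boundary. In other terms, Tor(R/I, K) vanishes beyond the number
  of variables.\<close>

theorem minimal_resolution_finite:
  fixes F :: "('v::finite, 'k::comm_ring_1) free_complex"
  assumes "minimal_graded_free_resolution F I" and "card (UNIV :: 'v set) \<le> i"
  shows "rk F (Suc i) = 0"
proof (rule ccontr)
  assume pos: "rk F (Suc i) \<noteq> 0"
  have F: "graded_free_resolution F I"
    using assms by (simp add: minimal_graded_free_resolution_def)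
  have entries: "diff_fun F i t s \<in> irrelevant_ideal" if "t < rk F i" "s < rk F (Suc i)" for i t s
  proof -
    have "diff F i $$ (t, s) \<in> elements_mat (diff F i)"
      using that resolution_carrier[OF F, of i] by (intro elements_matI) auto
    then show ?thesis
      using assms(1) by (auto simp: minimal_graded_free_resolution_def diff_fun_def)
  qed
  define e :: "nat \<Rightarrow> ('v, 'k) mpoly" where "e = (\<lambda>s. if s = 0 then 1 else 0)"
  have "mat_app (rk F (Suc i)) (diff_fun F i) e t \<in> monomial_prime UNIV" if "t < rk F i" for t
    using entries[OF that, of 0] pos
    by (simp add: mat_app_def e_def if_distrib sum.delta monomial_prime_UNIV cong: if_cong)
  then obtain w where w: "e 0 - mat_app (rk F (Suc (Suc i))) (diff_fun F (Suc i)) w 0 \<in> monomial_prime UNIV"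
    using exact_mod_monomial_prime[of UNIV "rk F" "diff_fun F" i e] pos assms(2)
      diff_fun_complex[OF F] diff_fun_exact[OF F] by auto
  have "mat_app (rk F (Suc (Suc i))) (diff_fun F (Suc i)) w 0 \<in> monomial_prime UNIV"
    unfolding mat_app_def
  proof (rule monomial_prime_sum)
    fix s assume "s \<in> {..<rk F (Suc (Suc i))}"
    then show "diff_fun F (Suc i) 0 s * w s \<in> monomial_prime UNIV"
      using monomial_prime_mult[of "diff_fun F (Suc i) 0 s" UNIV "w s"] entries[of 0 "Suc i" s] pos
      by (simp add: monomial_prime_UNIV mult.commute)
  qed
  from monomial_prime_add[OF w this] show False
    by (simp add: e_def monomial_prime_UNIV irrelevant_ideal_def)
qed

section \<open>Regular sequences with coprime leading monomials\<close>

text \<open>The ideal generated by \<open>A 0\<close>, ..., \<open>A (k - 1)\<close>, built so that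
  inductions can split off the last generator, as regular sequences require.\<close>

primrec ideal_span :: "(nat \<Rightarrow> 'a::comm_ring_1) \<Rightarrow> nat \<Rightarrow> 'a set" where
  "ideal_span A 0 = {0}"
| "ideal_span A (Suc k) = {h + A k * c | h c. h \<in> ideal_span A k}"

lemma ideal_span_Suc_iff: "f \<in> ideal_span A (Suc k) \<longleftrightarrow> (\<exists>h\<in>ideal_span A k. \<exists>c. f = h + A k * c)"
  by auto

declare ideal_span.simps(2) [simp del]

lemma ideal_span_0 [simp]: "0 \<in> ideal_span A k"
proof (induction k)
  case (Suc k)
  then show ?case unfolding ideal_span_Suc_iff by (intro bexI[of _ 0] exI[of _ 0]) auto
qed simp

lemma ideal_span_add: "f \<in> ideal_span A k \<Longrightarrow> g \<in> ideal_span A k \<Longrightarrow> f + g \<in> ideal_span A k"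
proof (induction k arbitrary: f g)
  case (Suc k)
  then obtain a b c d where "a \<in> ideal_span A k" "f = a + A k * b" "c \<in> ideal_span A k" "g = c + A k * d"
    unfolding ideal_span_Suc_iff by blast
  then show ?case unfolding ideal_span_Suc_iff
    by (intro bexI[of _ "a + c"] exI[of _ "b + d"]) (auto simp: algebra_simps Suc.IH)
qed simp

lemma ideal_span_mult: "f \<in> ideal_span A k \<Longrightarrow> g * f \<in> ideal_span A k"
proof (induction k arbitrary: f)
  case (Suc k)
  then obtain a b where "a \<in> ideal_span A k" "f = a + A k * b"
    unfolding ideal_span_Suc_iff by blast
  moreover from this have "g * f = g * a + A k * (g * b)" by (simp add: algebra_simps)
  ultimately show ?case unfolding ideal_span_Suc_iff using Suc.IH by blast
qed simp

lemma ideal_span_mult_right: "f \<in> ideal_span A k \<Longrightarrow> f * g \<in> ideal_span A k"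
  using ideal_span_mult[of f A k g] by (simp add: mult.commute)

lemma ideal_span_uminus: "f \<in> ideal_span A k \<Longrightarrow> - f \<in> ideal_span A k"
  using ideal_span_mult[of f A k "- 1"] by simp

lemma ideal_span_diff: "f \<in> ideal_span A k \<Longrightarrow> g \<in> ideal_span A k \<Longrightarrow> f - g \<in> ideal_span A k"
  using ideal_span_add[of f A k "- g"] ideal_span_uminus[of g A k] by simp

lemma ideal_span_sum: "(\<And>x. x \<in> Y \<Longrightarrow> f x \<in> ideal_span A k) \<Longrightarrow> sum f Y \<in> ideal_span A k"
  by (induction Y rule: infinite_finite_induct) (auto intro: ideal_span_add)

lemma ideal_span_mono: "j \<le> k \<Longrightarrow> ideal_span A j \<subseteq> ideal_span A k"
proof (induction k rule: dec_induct)
  case (step k)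
  have "f \<in> ideal_span A (Suc k)" if "f \<in> ideal_span A k" for f
    unfolding ideal_span_Suc_iff using that by (intro bexI[of _ f] exI[of _ 0]) auto
  with step.IH show ?case by blast
qed simp

lemma generator_in_ideal_span:
  assumes "j < k"
  shows "A j \<in> ideal_span A k"
proof -
  have "A j \<in> ideal_span A (Suc j)"
    unfolding ideal_span_Suc_iff by (intro bexI[of _ 0] exI[of _ 1]) auto
  then show ?thesis using ideal_span_mono[of "Suc j" k A] assms by auto
qed

text \<open>A weight replaces a monomial order. It need not separate monomials; it only has to
  single out the monomial \<open>lm k\<close>, of coefficient 1, in each generator
  \<open>A k\<close>. A general polynomial may therefore have several monomials of top weight, which
  is why \<open>is_top\<close> is a relation.\<close>

locale coprime_leads =
  fixes A :: "nat \<Rightarrow> ('v, 'k::comm_ring_1) mpoly"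
    and lm :: "nat \<Rightarrow> 'v \<Rightarrow>\<^sub>0 nat" and \<omega> :: "('v \<Rightarrow>\<^sub>0 nat) \<Rightarrow> nat" and N :: nat
  assumes weight_add: "\<omega> (a + b) = \<omega> a + \<omega> b"
    and lead: "k < N \<Longrightarrow> m \<in> keys (A k - Poly_Mapping.single (lm k) 1) \<Longrightarrow> \<omega> m < \<omega> (lm k)"
    and coprime: "j < N \<Longrightarrow> k < N \<Longrightarrow> j \<noteq> k \<Longrightarrow> lookup (lm j) v = 0 \<or> lookup (lm k) v = 0"
begin

definition mdvd :: "('v \<Rightarrow>\<^sub>0 nat) \<Rightarrow> ('v \<Rightarrow>\<^sub>0 nat) \<Rightarrow> bool" where
  "mdvd a m \<longleftrightarrow> (\<forall>v. lookup a v \<le> lookup m v)"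

lemma mdvd_decomp: "mdvd a m \<Longrightarrow> m = a + (m - a)"
  by (intro poly_mapping_eqI) (simp add: mdvd_def lookup_add lookup_minus)

definition reduced :: "nat \<Rightarrow> ('v, 'k) mpoly \<Rightarrow> bool" where
  "reduced k f \<longleftrightarrow> (\<forall>m\<in>keys f. \<forall>j<k. \<not> mdvd (lm j) m)"

lemma reduced_diff: "reduced k f \<Longrightarrow> reduced k g \<Longrightarrow> reduced k (f - g)"
  unfolding reduced_def by (blast dest: keys_minusE)

definition is_top :: "('v \<Rightarrow>\<^sub>0 nat) \<Rightarrow> ('v, 'k) mpoly \<Rightarrow> bool" where
  "is_top m f \<longleftrightarrow> m \<in> keys f \<and> (\<forall>m'\<in>keys f. \<omega> m' \<le> \<omega> m)"

lemma ex_is_top: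
  assumes "f \<noteq> 0"
  shows "\<exists>m. is_top m f"
proof -
  have "Max (\<omega> ` keys f) \<in> \<omega> ` keys f" using assms by (intro Max_in) auto
  then obtain m where "m \<in> keys f" "Max (\<omega> ` keys f) = \<omega> m" by blast
  then show ?thesis
    by (intro exI[of _ m]) (auto simp: is_top_def simp flip: \<open>Max _ = _\<close>)
qed

text \<open>The division algorithm, by induction on a bound for the weight: modulo
  \<open>A j\<close> a multiple of \<open>lm j\<close> is replaced by a multiple of the lower terms
  of \<open>A j\<close>, all of smaller weight.\<close>

lemma ex_reduced_aux:
  assumes "k \<le> N" "\<And>m. m \<in> keys f \<Longrightarrow> \<omega> m < n"
  shows "\<exists>h\<in>ideal_span A k. reduced k (f - h)"
  using assms(2)
proof (induction n arbitrary: f)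
  case 0
  then have "f = 0" using Poly_Mapping.keys_eq_empty by fastforce
  then show ?case by (intro bexI[of _ 0]) (auto simp: reduced_def)
next
  case (Suc n)
  show ?case
  proof (induction f rule: poly_mapping_additive_induct)
    case zero
    then show ?case by (intro bexI[of _ 0]) (auto simp: reduced_def)
  next
    case (add f g)
    then obtain a b where ab: "a \<in> ideal_span A k" "b \<in> ideal_span A k"
      and red: "reduced k (f - a)" "reduced k (g - b)" by blast
    have "reduced k 0" by (simp add: reduced_def)
    then have "reduced k (f - a - (0 - (g - b)))"
      by (intro reduced_diff[of _ _ "0 - _"] red reduced_diff[of _ 0])
    moreover have "f - a - (0 - (g - b)) = f + g - (a + b)" by (simp add: algebra_simps)
    ultimately show ?case using ab by (metis ideal_span_add)
  next
    case (single m c)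
    show ?case
    proof (cases "\<exists>j<k. mdvd (lm j) m")
      case False
      then show ?thesis by (intro bexI[of _ 0]) (auto simp: reduced_def split: if_splits)
    next
      case True
      then obtain j where j: "j < k" "mdvd (lm j) m" by blast
      define b where "b = m - lm j"
      have m: "m = lm j + b" unfolding b_def by (rule mdvd_decomp) fact
      let ?B = "A j - Poly_Mapping.single (lm j) 1" and ?s = "Poly_Mapping.single b c"
      have eq: "Poly_Mapping.single m c = A j * ?s - ?B * ?s"
        by (simp add: left_diff_distrib mult_single m)
      have "\<omega> x < n" if "x \<in> keys (?B * ?s)" for x
        using that
      proof (rule keys_multE)
        fix y z assume "y \<in> keys ?B" "z \<in> keys ?s" "x = y + z"
        then have "z = b" "\<omega> y < \<omega> (lm j)"
          using lead[of j y] j(1) assms(1) by (auto split: if_splits)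
        then have "\<omega> x < \<omega> m" using \<open>x = y + z\<close> by (simp add: m weight_add)
        moreover have "\<omega> m < Suc n" by (rule Suc.prems) fact
        ultimately show ?thesis by simp
      qed
      with Suc.IH obtain h where h: "h \<in> ideal_span A k" "reduced k (?B * ?s - h)" by blast
      have "reduced k (0 - (?B * ?s - h))"
        using h(2) by (intro reduced_diff[of _ 0]) (simp_all add: reduced_def[of k 0])
      moreover have "A j * ?s - h \<in> ideal_span A k"
        using h(1) j(1) by (intro ideal_span_diff ideal_span_mult_right generator_in_ideal_span)
      ultimately show ?thesis
        by (intro bexI[of _ "A j * ?s - h"]) (simp_all add: eq)
    qed
  qed
qed

lemma ex_reduced:
  assumes "k \<le> N"
  shows "\<exists>h\<in>ideal_span A k. reduced k (f - h)"
proof -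
  obtain n where "\<forall>x\<in>\<omega> ` keys f. x < n"
    using finite_nat_set_iff_bounded[of "\<omega> ` keys f"] by auto
  then show ?thesis using assms by (intro ex_reduced_aux[of k f n]) auto
qed

lemma keys_times_generator:
  assumes "k < N" and r: "\<And>x. x \<in> keys r \<Longrightarrow> \<omega> x \<le> e"
    and M: "M \<in> keys (r * A k)"
  shows "\<omega> M \<le> e + \<omega> (lm k)" and "\<omega> M = e + \<omega> (lm k) \<Longrightarrow> \<exists>m\<in>keys r. M = m + lm k"
proof -
  let ?B = "A k - Poly_Mapping.single (lm k) 1"
  have "r * A k = r * Poly_Mapping.single (lm k) 1 + r * ?B" by (simp add: algebra_simps)
  with M consider "M \<in> keys (r * Poly_Mapping.single (lm k) 1)" | "M \<in> keys (r * ?B)"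
    by (metis keys_addE)
  then have "(\<exists>m\<in>keys r. M = m + lm k) \<or> \<omega> M < e + \<omega> (lm k)"
  proof cases
    case 1
    then show ?thesis by (rule keys_times_single) blast
  next
    case 2
    then obtain a b where "a \<in> keys r" "b \<in> keys ?B" "M = a + b" by (rule keys_multE)
    then show ?thesis using r[of a] lead[OF assms(1), of b] by (simp add: weight_add)
  qed
  then show "\<omega> M \<le> e + \<omega> (lm k)" "\<omega> M = e + \<omega> (lm k) \<Longrightarrow> \<exists>m\<in>keys r. M = m + lm k"
    using r by (auto simp: weight_add)
qed

lemma lookup_times_generator:
  assumes "k < N" and m: "is_top m r"
  shows "lookup (r * A k) (m + lm k) = lookup r m"
proof -
  let ?B = "A k - Poly_Mapping.single (lm k) 1"
  have "m + lm k \<notin> keys (r * ?B)"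
  proof
    assume "m + lm k \<in> keys (r * ?B)"
    then obtain a b where "a \<in> keys r" "b \<in> keys ?B" "m + lm k = a + b" by (rule keys_multE)
    moreover from this(3) have "\<omega> m + \<omega> (lm k) = \<omega> a + \<omega> b" by (metis weight_add)
    ultimately show False using m lead[OF assms(1), of b] by (force simp: is_top_def)
  qed
  moreover have "r * A k = r * Poly_Mapping.single (lm k) 1 + r * ?B" by (simp add: algebra_simps)
  ultimately show ?thesis
    by (simp add: lookup_add lookup_times_single_add Poly_Mapping.in_keys_iff)
qed

text \<open>By coprimality \<open>lm k\<close> contributes nothing to the variables of
  \<open>lm j\<close>.\<close>

lemma not_mdvd_times_lead:
  assumes "j < k" "k < N" "\<not> mdvd (lm j) m"
  shows "\<not> mdvd (lm j) (m + lm k)"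
proof
  assume *: "mdvd (lm j) (m + lm k)"
  have "lookup (lm j) v \<le> lookup m v" for v
    using *[unfolded mdvd_def, rule_format, of v] coprime[of j k v] assms(1,2)
    by (auto simp: lookup_add)
  with assms(3) show False by (simp add: mdvd_def)
qed

text \<open>Buchberger's criterion for coprime leading monomials. Taking the coefficient of the last
  generator reduced keeps its top monomials apart from those of the rest of the sum.\<close>

lemma is_top_ideal_span:
  assumes "k \<le> N" "h \<in> ideal_span A k" "is_top M h"
  shows "\<exists>j<k. mdvd (lm j) M"
  using assms
proof (induction k arbitrary: h M)
  case 0
  then show ?case by (simp add: is_top_def)
next
  case (Suc k)
  obtain h0 c where h0: "h0 \<in> ideal_span A k" "h = h0 + A k * c"
    using Suc.prems(2) unfolding ideal_span_Suc_iff by blast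
  obtain h1 where h1: "h1 \<in> ideal_span A k" "reduced k (c - h1)"
    using ex_reduced[of k c] Suc.prems(1) by auto
  define r where "r = c - h1"
  define h' where "h' = h0 + A k * h1"
  have h: "h = h' + r * A k" by (simp add: h0 h'_def r_def algebra_simps)
  have h': "h' \<in> ideal_span A k"
    unfolding h'_def by (intro ideal_span_add ideal_span_mult h0 h1)
  have r: "reduced k r" using h1 by (simp add: r_def)
  have kN: "k < N" using Suc.prems(1) by simp
  have IH: "\<exists>j<k. mdvd (lm j) M" if "is_top M h'" for M
    using Suc.IH[of h' M] h' that kN by auto
  have M: "M \<in> keys h" "\<And>m. m \<in> keys h \<Longrightarrow> \<omega> m \<le> \<omega> M"
    using Suc.prems(3) by (auto simp: is_top_def)
  show ?case
  proof (cases "r = 0")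
    case True
    then have "is_top M h'" using Suc.prems(3) h by simp
    then show ?thesis using IH less_Suc_eq by blast
  next
    case False
    then obtain m where m: "is_top m r" using ex_is_top by blast
    define W where "W = \<omega> m + \<omega> (lm k)"
    have rA: "\<omega> x \<le> W" "\<omega> x = W \<Longrightarrow> \<exists>y\<in>keys r. x = y + lm k" if "x \<in> keys (r * A k)" for x
      using keys_times_generator[OF kN _ that, of "\<omega> m"] m by (auto simp: is_top_def W_def)
    have M': "M \<in> keys h' \<or> M \<in> keys (r * A k)" using M(1) h by (auto dest: keys_addE)
    \<comment> \<open>\<open>W\<close> is the top weight of \<open>r * A k\<close>. If
      \<open>h'\<close> does not exceed it, then \<open>m + lm k\<close> survives in
      \<open>h\<close>, since \<open>r\<close> is reduced, so the top weight of \<open>h\<close> is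
      \<open>W\<close>. Otherwise the top monomials of \<open>h'\<close> lie above everything in
      \<open>r * A k\<close> and are those of \<open>h\<close>.\<close>
    show ?thesis
    proof (cases "\<forall>x\<in>keys h'. \<omega> x \<le> W")
      case True
      have "m + lm k \<in> keys h"
      proof -
        have "m + lm k \<notin> keys h'"
        proof
          assume "m + lm k \<in> keys h'"
          then have "is_top (m + lm k) h'" using True by (simp add: is_top_def W_def weight_add)
          then obtain j where "j < k" "mdvd (lm j) (m + lm k)" using IH by blast
          moreover from this have "\<not> mdvd (lm j) m" using r m by (auto simp: reduced_def is_top_def)
          ultimately show False using not_mdvd_times_lead kN by blast
        qed
        then show ?thesis
          using lookup_times_generator[OF kN m] m
          by (simp add: h Poly_Mapping.in_keys_iff lookup_add is_top_def)
      qed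
      then have "W \<le> \<omega> M" using M(2) by (auto simp: W_def weight_add[symmetric])
      then have W: "\<omega> M = W" using M' True rA(1) by (auto intro: antisym)
      from M' show ?thesis
      proof
        assume "M \<in> keys h'"
        then have "is_top M h'" using True W by (simp add: is_top_def)
        then show ?thesis using IH less_Suc_eq by blast
      next
        assume "M \<in> keys (r * A k)"
        then obtain y where "M = y + lm k" using rA(2) W by blast
        then have "mdvd (lm k) M" by (simp add: mdvd_def lookup_add)
        then show ?thesis by blast
      qed
    next
      case False
      then obtain x where x: "x \<in> keys h'" "W < \<omega> x" by (auto simp: not_le)
      then have "h' \<noteq> 0" by auto
      then obtain x' where x': "is_top x' h'" using ex_is_top by blast
      with x have "W < \<omega> x'" by (force simp: is_top_def)
      then have "x' \<notin> keys (r * A k)" using rA(1) by force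
      then have "x' \<in> keys h" using x' by (simp add: h Poly_Mapping.in_keys_iff lookup_add is_top_def)
      then have "\<omega> x' \<le> \<omega> M" by (rule M)
      then have "M \<notin> keys (r * A k)" using \<open>W < \<omega> x'\<close> rA(1) by force
      then have "is_top M h'" using M' x' \<open>\<omega> x' \<le> \<omega> M\<close> by (force simp: is_top_def)
      then show ?thesis using IH less_Suc_eq by blast
    qed
  qed
qed

text \<open>Reduce \<open>f\<close> modulo the first \<open>k\<close> generators. If a remainder
  were left with top monomial \<open>m\<close>, then \<open>m + lm k\<close> would be a top monomial
  of an element of the ideal, hence divisible by some earlier \<open>lm j\<close>; coprimality moves
  this divisibility to \<open>m\<close>, against reducedness.\<close>

lemma regular:
  assumes k: "k < N" and f: "A k * f \<in> ideal_span A k"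
  shows "f \<in> ideal_span A k"
proof -
  obtain h where h: "h \<in> ideal_span A k" "reduced k (f - h)"
    using ex_reduced[of k f] k by auto
  have "f - h = 0"
  proof (rule ccontr)
    assume "f - h \<noteq> 0"
    then obtain m where m: "is_top m (f - h)" using ex_is_top by blast
    have "A k * f - A k * h \<in> ideal_span A k"
      by (intro ideal_span_diff ideal_span_mult f h)
    then have in_span: "(f - h) * A k \<in> ideal_span A k" by (simp add: algebra_simps)
    have "m + lm k \<in> keys ((f - h) * A k)"
      using lookup_times_generator[OF k m] m by (simp add: Poly_Mapping.in_keys_iff is_top_def)
    then have "is_top (m + lm k) ((f - h) * A k)"
      using keys_times_generator(1)[OF k, of "f - h" "\<omega> m"] m by (simp add: is_top_def weight_add)
    then obtain j where "j < k" "mdvd (lm j) (m + lm k)"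
      using is_top_ideal_span[OF _ in_span] k by auto
    moreover from this have "\<not> mdvd (lm j) m" using h(2) m by (auto simp: reduced_def is_top_def)
    ultimately show False using not_mdvd_times_lead k by blast
  qed
  then show ?thesis using h by simp
qed

end

section \<open>Regular sequences and the length of resolutions\<close>

text \<open>Matrices as functions with an explicit inner dimension: all differentials have one type,
  and associativity holds without side conditions on the indices.\<close>

definition mmul :: "nat \<Rightarrow> (nat \<Rightarrow> nat \<Rightarrow> 'a) \<Rightarrow> (nat \<Rightarrow> nat \<Rightarrow> 'a) \<Rightarrow> nat \<Rightarrow> nat \<Rightarrow> 'a::comm_ring_1" where
  "mmul n A B t u = (\<Sum>s<n. A t s * B s u)"

definition row_app :: "nat \<Rightarrow> (nat \<Rightarrow> 'a) \<Rightarrow> (nat \<Rightarrow> nat \<Rightarrow> 'a) \<Rightarrow> nat \<Rightarrow> 'a::comm_ring_1" where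
  "row_app n c A u = (\<Sum>s<n. c s * A s u)"

lemma mmul_assoc: "mmul n' (mmul n A B) C t u = mmul n A (mmul n' B C) t u"
  unfolding mmul_def sum_distrib_left sum_distrib_right
  by (subst sum.swap) (simp add: mult.assoc)

lemma row_app_assoc: "row_app n' (row_app n c A) B u = row_app n c (mmul n' A B) u"
  unfolding mmul_def row_app_def sum_distrib_left sum_distrib_right
  by (subst sum.swap) (simp add: mult.assoc)

lemma row_app_add: "row_app n (\<lambda>s. c s + d s) A u = row_app n c A u + row_app n d A u"
  by (simp add: row_app_def algebra_simps sum.distrib)

lemma row_app_diff: "row_app n (\<lambda>s. c s - d s) A u = row_app n c A u - row_app n d A u"
  by (simp add: row_app_def algebra_simps sum_subtractf)

lemma row_app_mult: "row_app n (\<lambda>s. g * c s) A u = g * row_app n c A u"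
  by (simp add: row_app_def sum_distrib_left algebra_simps)

lemma row_app_cong:
  "(\<And>s. s < n \<Longrightarrow> c s = d s) \<Longrightarrow> (\<And>s. s < n \<Longrightarrow> A s u = B s u) \<Longrightarrow> row_app n c A u = row_app n d B u"
  by (simp add: row_app_def)

lemma row_app_0 [simp]: "row_app n (\<lambda>_. 0) A u = 0"
  by (simp add: row_app_def)

text \<open>What the Ext argument needs of a free resolution of R/I once the augmentation is
  dropped; \<open>kills\<close> says that \<open>I\<close> times \<open>F_0\<close> lies in the
  image of \<open>D 0\<close>.\<close>

locale exact_complex =
  fixes r :: "nat \<Rightarrow> nat" and D :: "nat \<Rightarrow> nat \<Rightarrow> nat \<Rightarrow> 'a::comm_ring_1" and I :: "'a set"
  assumes complex: "t < r i \<Longrightarrow> u < r (Suc (Suc i)) \<Longrightarrow> mmul (r (Suc i)) (D i) (D (Suc i)) t u = 0"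
    and exact: "(\<And>t. t < r i \<Longrightarrow> (\<Sum>s<r (Suc i). D i t s * v s) = 0) \<Longrightarrow>
      \<exists>w. \<forall>s<r (Suc i). v s = (\<Sum>u<r (Suc (Suc i)). D (Suc i) s u * w u)"
    and kills: "g \<in> I \<Longrightarrow> t0 < r 0 \<Longrightarrow>
      \<exists>w. \<forall>t<r 0. (if t = t0 then g else 0) = (\<Sum>u<r (Suc 0). D 0 t u * w u)"
begin

text \<open>Multiplication by an element of \<open>I\<close> is null-homotopic.\<close>

lemma homotopy:
  assumes g: "g \<in> I"
  shows "\<exists>h. (\<forall>t<r 0. \<forall>x<r 0. mmul (r (Suc 0)) (D 0) (h 0) t x = (if t = x then g else 0)) \<and>
    (\<forall>i. \<forall>t<r (Suc i). \<forall>x<r (Suc i). mmul (r (Suc (Suc i))) (D (Suc i)) (h (Suc i)) t x =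
      (if t = x then g else 0) - mmul (r i) (h i) (D i) t x)"
proof -
  \<comment> \<open>The invariant \<open>D i * h * D i = g * D i\<close> says that
    \<open>g - h * D i\<close> consists of cycles; exactness lifts them to the next component of the
    homotopy.\<close>
  define P where "P = (\<lambda>i h. (\<forall>t<r i. \<forall>x<r (Suc i).
      mmul (r (Suc i)) (D i) (mmul (r i) h (D i)) t x = g * D i t x) \<and>
      (i = 0 \<longrightarrow> (\<forall>t<r 0. \<forall>x<r 0. mmul (r (Suc 0)) (D 0) h t x = (if t = x then g else 0))))"
  define Q where "Q = (\<lambda>i h h'. \<forall>t<r (Suc i). \<forall>x<r (Suc i). mmul (r (Suc (Suc i))) (D (Suc i)) h' t x =
      (if t = x then g else 0) - mmul (r i) h (D i) t x)"
  have "\<exists>h. \<forall>i. P i (h i) \<and> Q i (h i) (h (Suc i))"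
  proof (rule dependent_nat_choice)
    have "\<forall>x. \<exists>w. x < r 0 \<longrightarrow> (\<forall>t<r 0. (if t = x then g else 0) = (\<Sum>u<r (Suc 0). D 0 t u * w u))"
      using kills[OF g] by blast
    then obtain w where w: "\<And>x t. x < r 0 \<Longrightarrow> t < r 0 \<Longrightarrow>
        (if t = x then g else 0) = (\<Sum>u<r (Suc 0). D 0 t u * w x u)"
      by metis
    define h where "h = (\<lambda>u x. w x u)"
    have h: "mmul (r (Suc 0)) (D 0) h t x = (if t = x then g else 0)" if "t < r 0" "x < r 0" for t x
      using w[OF that(2,1)] by (simp add: mmul_def h_def)
    have "mmul (r (Suc 0)) (D 0) (mmul (r 0) h (D 0)) t x = g * D 0 t x" if "t < r 0" for t x
    proof -
      have "mmul (r (Suc 0)) (D 0) (mmul (r 0) h (D 0)) t x =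
          (\<Sum>s<r 0. mmul (r (Suc 0)) (D 0) h t s * D 0 s x)"
        unfolding mmul_assoc[symmetric] by (simp add: mmul_def)
      also have "\<dots> = (\<Sum>s<r 0. if s = t then g * D 0 s x else 0)"
        using h that by (intro sum.cong) auto
      finally show ?thesis using that by (simp add: sum.delta)
    qed
    then show "\<exists>h. P 0 h" using h by (intro exI[of _ h]) (auto simp: P_def)
  next
    fix h i assume "P i h"
    then have h: "\<And>t x. t < r i \<Longrightarrow> x < r (Suc i) \<Longrightarrow>
        mmul (r (Suc i)) (D i) (mmul (r i) h (D i)) t x = g * D i t x" by (auto simp: P_def)
    have "\<exists>w. \<forall>s<r (Suc i). (if s = x then g else 0) - mmul (r i) h (D i) s x =
        (\<Sum>u<r (Suc (Suc i)). D (Suc i) s u * w u)" if x: "x < r (Suc i)" for x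
    proof (rule exact)
      fix t assume t: "t < r i"
      have "(\<Sum>s<r (Suc i). D i t s * ((if s = x then g else 0) - mmul (r i) h (D i) s x)) =
          (\<Sum>s<r (Suc i). if s = x then D i t s * g else 0) - mmul (r (Suc i)) (D i) (mmul (r i) h (D i)) t x"
        unfolding mmul_def[of "r (Suc i)"] sum_subtractf[symmetric]
        by (intro sum.cong) (auto simp: right_diff_distrib)
      then show "(\<Sum>s<r (Suc i). D i t s * ((if s = x then g else 0) - mmul (r i) h (D i) s x)) = 0"
        using h[OF t x] x by (simp add: sum.delta mult.commute)
    qed
    then have "\<forall>x. \<exists>w. x < r (Suc i) \<longrightarrow> (\<forall>s<r (Suc i). (if s = x then g else 0) - mmul (r i) h (D i) s x =
        (\<Sum>u<r (Suc (Suc i)). D (Suc i) s u * w u))" by blast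
    then obtain w where w: "\<And>x s. x < r (Suc i) \<Longrightarrow> s < r (Suc i) \<Longrightarrow>
        (if s = x then g else 0) - mmul (r i) h (D i) s x = (\<Sum>u<r (Suc (Suc i)). D (Suc i) s u * w x u)"
      by metis
    define h' where "h' = (\<lambda>u x. w x u)"
    have h': "mmul (r (Suc (Suc i))) (D (Suc i)) h' t x = (if t = x then g else 0) - mmul (r i) h (D i) t x"
      if "t < r (Suc i)" "x < r (Suc i)" for t x
      using w[OF that(2,1)] by (simp add: mmul_def h'_def)
    have "mmul (r (Suc (Suc i))) (D (Suc i)) (mmul (r (Suc i)) h' (D (Suc i))) t x = g * D (Suc i) t x"
      if t: "t < r (Suc i)" and x: "x < r (Suc (Suc i))" for t x
    proof -
      have "mmul (r (Suc (Suc i))) (D (Suc i)) (mmul (r (Suc i)) h' (D (Suc i))) t x =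
          (\<Sum>s<r (Suc i). mmul (r (Suc (Suc i))) (D (Suc i)) h' t s * D (Suc i) s x)"
        unfolding mmul_assoc[symmetric] by (simp add: mmul_def)
      also have "\<dots> = (\<Sum>s<r (Suc i). (if s = t then g * D (Suc i) s x else 0) - mmul (r i) h (D i) t s * D (Suc i) s x)"
        using h' t by (intro sum.cong) (auto simp: left_diff_distrib)
      also have "\<dots> = g * D (Suc i) t x - mmul (r (Suc i)) (mmul (r i) h (D i)) (D (Suc i)) t x"
        using t by (simp add: sum_subtractf sum.delta mmul_def)
      also have "mmul (r (Suc i)) (mmul (r i) h (D i)) (D (Suc i)) t x =
          (\<Sum>s<r i. h t s * mmul (r (Suc i)) (D i) (D (Suc i)) s x)"
        unfolding mmul_assoc by (simp add: mmul_def)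
      also have "\<dots> = 0" using complex x by (intro sum.neutral) auto
      finally show ?thesis by simp
    qed
    then show "\<exists>h'. P (Suc i) h' \<and> Q i h h'"
      using h' by (intro exI[of _ h']) (auto simp: P_def Q_def)
  qed
  then obtain h where h: "\<And>i. P i (h i)" "\<And>i. Q i (h i) (h (Suc i))" by blast
  show ?thesis
    using h(1)[of 0] h(2) unfolding P_def Q_def by (intro exI[of _ h]) simp
qed

text \<open>The value 0 in degree 0 means that a cochain there is a coboundary only if it vanishes,
  so cohomology classes in all degrees are treated uniformly.\<close>

definition coboundary :: "nat \<Rightarrow> (nat \<Rightarrow> 'a) \<Rightarrow> nat \<Rightarrow> 'a" where
  "coboundary i e t = (case i of 0 \<Rightarrow> 0 | Suc j \<Rightarrow> row_app (r j) e (D j) t)"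

lemma coboundary_0 [simp]: "coboundary 0 e t = 0"
  by (simp add: coboundary_def)

lemma coboundary_Suc [simp]: "coboundary (Suc i) e = row_app (r i) e (D i)"
  by (simp add: coboundary_def fun_eq_iff)

lemma row_app_coboundary:
  assumes "s < r (Suc i)"
  shows "row_app (r i) (coboundary i e) (D i) s = 0"
proof (cases i)
  case (Suc j)
  then have "row_app (r i) (coboundary i e) (D i) s = row_app (r j) e (mmul (r i) (D j) (D i)) s"
    by (simp add: row_app_assoc)
  also have "\<dots> = 0" unfolding row_app_def using complex assms Suc by (intro sum.neutral) auto
  finally show ?thesis .
qed (simp add: row_app_def)

text \<open>The transposed homotopy: multiplication by \<open>g\<close> maps cocycles to
  coboundaries, so \<open>g\<close> annihilates the cohomology of the dual complex.\<close>

lemma homotopy_row: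
  assumes g: "g \<in> I"
  shows "\<exists>c' h. \<forall>t<r i. g * c t = row_app (r (Suc i)) (row_app (r i) c (D i)) h t + coboundary i c' t"
proof -
  obtain h where h0: "\<And>t x. t < r 0 \<Longrightarrow> x < r 0 \<Longrightarrow> mmul (r (Suc 0)) (D 0) (h 0) t x = (if t = x then g else 0)"
    and hS: "\<And>i t x. t < r (Suc i) \<Longrightarrow> x < r (Suc i) \<Longrightarrow> mmul (r (Suc (Suc i))) (D (Suc i)) (h (Suc i)) t x =
      (if t = x then g else 0) - mmul (r i) (h i) (D i) t x"
    using homotopy[OF g] by blast
  have delta: "row_app n c (\<lambda>t x. if t = x then g else 0) x = g * c x" if "x < n" for n x
    using that by (simp add: row_app_def if_distrib sum.delta mult.commute cong: if_cong)
  show ?thesis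
  proof (cases i)
    case 0
    have "row_app (r (Suc 0)) (row_app (r 0) c (D 0)) (h 0) x = g * c x" if "x < r 0" for x
      unfolding row_app_assoc delta[OF that, symmetric]
      using h0 that by (intro row_app_cong) auto
    then show ?thesis using 0 by (intro exI[of _ c] exI[of _ "h 0"]) auto
  next
    case (Suc j)
    have "row_app (r (Suc i)) (row_app (r i) c (D i)) (h i) x =
        g * c x - row_app (r j) (row_app (r i) c (h j)) (D j) x" if "x < r i" for x
    proof -
      have "row_app (r (Suc i)) (row_app (r i) c (D i)) (h i) x =
          row_app (r i) c (\<lambda>t x. (if t = x then g else 0) - mmul (r j) (h j) (D j) t x) x"
        unfolding row_app_assoc using hS that Suc by (intro row_app_cong) auto
      also have "\<dots> = row_app (r i) c (\<lambda>t x. if t = x then g else 0) x - row_app (r i) c (mmul (r j) (h j) (D j)) x"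
        by (simp add: row_app_def right_diff_distrib sum_subtractf)
      finally show ?thesis using delta[OF that] by (simp add: row_app_assoc)
    qed
    then show ?thesis using Suc
      by (intro exI[of _ "row_app (r i) c (h j)"] exI[of _ "h i"]) auto
  qed
qed

text \<open>In the next two lemmas the rows \<open>c\<close> are cochains of \<open>Hom(F, R/J\<^sub>k)\<close>, where \<open>J\<^sub>k\<close> is
  generated by \<open>A\<^sub>0, \<dots>, A\<^sub>p\<^sub>+\<^sub>k\<^sub>-\<^sub>1\<close>. The first says that \<open>Ext\<^sup>i(R/I, R/J\<^sub>k) = 0\<close> for \<open>i + k < q\<close>, the
  second follows a nonzero class through the connecting maps
  \<open>Ext\<^sup>i(R/I, R/J\<^sub>k\<^sub>+\<^sub>1) \<rightarrow> Ext\<^sup>i\<^sup>+\<^sup>1(R/I, R/J\<^sub>k)\<close>.\<close>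

lemma ext_vanishing:
  assumes reg: "\<And>k f. k < q \<Longrightarrow> A (p + k) * f \<in> ideal_span A (p + k) \<Longrightarrow> f \<in> ideal_span A (p + k)"
    and AI: "\<And>k. k < q \<Longrightarrow> A (p + k) \<in> I"
    and "i + k < q"
    and "\<And>s. s < r (Suc i) \<Longrightarrow> row_app (r i) c (D i) s \<in> ideal_span A (p + k)"
  shows "\<exists>e. \<forall>t<r i. c t - coboundary i e t \<in> ideal_span A (p + k)"
  using assms(3,4)
proof (induction i arbitrary: k c)
  case 0
  let ?J = "ideal_span A (p + k)" and ?g = "A (p + k)"
  obtain c' h where *: "\<forall>t<r 0. ?g * c t = row_app (r (Suc 0)) (row_app (r 0) c (D 0)) h t + coboundary 0 c' t"
    using homotopy_row[OF AI] 0(1) by force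
  have "c t \<in> ?J" if "t < r 0" for t
  proof (rule reg)
    have "row_app (r (Suc 0)) (row_app (r 0) c (D 0)) h t \<in> ?J"
      unfolding row_app_def[of "r (Suc 0)"] using 0(2) by (intro ideal_span_sum ideal_span_mult_right) auto
    then show "?g * c t \<in> ?J" using * that by simp
  qed (use 0 in simp)
  then show ?case by simp
next
  case (Suc i)
  let ?J = "ideal_span A (p + k)" and ?g = "A (p + k)"
  have J_Suc: "ideal_span A (p + Suc k) = ideal_span A (Suc (p + k))" by simp
  obtain c' h where *: "\<And>t. t < r (Suc i) \<Longrightarrow> ?g * c t =
      row_app (r (Suc (Suc i))) (row_app (r (Suc i)) c (D (Suc i))) h t + row_app (r i) c' (D i) t"
    using homotopy_row[OF AI, of k "Suc i" c] Suc.prems(1) by auto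
  have J: "?g * c t - row_app (r i) c' (D i) t \<in> ?J" if "t < r (Suc i)" for t
  proof -
    have "row_app (r (Suc (Suc i))) (row_app (r (Suc i)) c (D (Suc i))) h t \<in> ?J"
      unfolding row_app_def[of "r (Suc (Suc i))"]
      using Suc.prems(2) by (intro ideal_span_sum ideal_span_mult_right) auto
    then show ?thesis using * that by simp
  qed
  \<comment> \<open>Modulo the one larger ideal, \<open>?g * c\<close> disappears and
    \<open>c'\<close> becomes a cocycle one degree lower, to which the induction hypothesis applies
    with \<open>Suc k\<close>.\<close>
  have "row_app (r i) c' (D i) t \<in> ideal_span A (p + Suc k)" if "t < r (Suc i)" for t
    unfolding J_Suc ideal_span_Suc_iff
    using ideal_span_uminus[OF J[OF that]]
    by (intro bexI[of _ "- (?g * c t - row_app (r i) c' (D i) t)"] exI[of _ "c t"]) auto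
  then obtain e where e: "\<And>t. t < r i \<Longrightarrow> c' t - coboundary i e t \<in> ideal_span A (p + Suc k)"
    using Suc.IH[of "Suc k" c'] Suc.prems(1) by auto
  have "\<forall>t. \<exists>h f. t < r i \<longrightarrow> h \<in> ?J \<and> c' t - coboundary i e t = h + ?g * f"
    using e unfolding J_Suc ideal_span_Suc_iff by blast
  then obtain h' f where hf: "\<And>t. t < r i \<Longrightarrow> h' t \<in> ?J"
    "\<And>t. t < r i \<Longrightarrow> c' t - coboundary i e t = h' t + ?g * f t" by metis
  \<comment> \<open>The coboundary part of \<open>c'\<close> is killed by the differential and what
    remains is \<open>?g\<close> times \<open>f\<close>; regularity then cancels
    \<open>?g\<close>.\<close>
  have "c t - row_app (r i) f (D i) t \<in> ?J" if t: "t < r (Suc i)" for t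
  proof (rule reg)
    have "row_app (r i) c' (D i) t = row_app (r i) (\<lambda>t. coboundary i e t + (h' t + ?g * f t)) (D i) t"
      using hf(2) by (intro row_app_cong) (auto simp: algebra_simps)
    also have "\<dots> = row_app (r i) h' (D i) t + ?g * row_app (r i) f (D i) t"
      by (simp add: row_app_add row_app_mult row_app_coboundary[OF t])
    finally have "?g * (c t - row_app (r i) f (D i) t) =
        (?g * c t - row_app (r i) c' (D i) t) + row_app (r i) h' (D i) t"
      by (simp add: algebra_simps)
    moreover have "row_app (r i) h' (D i) t \<in> ?J"
      unfolding row_app_def using hf(1) by (intro ideal_span_sum ideal_span_mult_right) auto
    ultimately show "?g * (c t - row_app (r i) f (D i) t) \<in> ?J"
      using J[OF t] by (simp add: ideal_span_add)
  qed (use Suc in simp)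
  then show ?case by auto
qed

lemma ext_connecting:
  assumes reg: "\<And>k f. k < q \<Longrightarrow> A (p + k) * f \<in> ideal_span A (p + k) \<Longrightarrow> f \<in> ideal_span A (p + k)"
    and AI: "\<And>k. k < q \<Longrightarrow> A (p + k) \<in> I"
    and ik: "i + Suc k = q"
    and cocycle: "\<And>s. s < r (Suc i) \<Longrightarrow> row_app (r i) c (D i) s - A (p + k) * c' s \<in> ideal_span A (p + k)"
    and nonzero: "\<not> (\<exists>e. \<forall>t<r i. c t - coboundary i e t \<in> ideal_span A (p + Suc k))"
  shows "u < r (Suc (Suc i)) \<Longrightarrow> row_app (r (Suc i)) c' (D (Suc i)) u \<in> ideal_span A (p + k)"
    and "\<not> (\<exists>e. \<forall>t<r (Suc i). c' t - coboundary (Suc i) e t \<in> ideal_span A (p + k))"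
proof -
  let ?J = "ideal_span A (p + k)" and ?g = "A (p + k)"
  show "row_app (r (Suc i)) c' (D (Suc i)) u \<in> ?J" if u: "u < r (Suc (Suc i))"
  proof (rule reg)
    let ?f = "\<lambda>s. row_app (r i) c (D i) s - ?g * c' s"
    have "row_app (r (Suc i)) ?f (D (Suc i)) u = - (?g * row_app (r (Suc i)) c' (D (Suc i)) u)"
      using row_app_coboundary[OF u, of c] by (simp add: row_app_diff row_app_mult)
    moreover have "row_app (r (Suc i)) ?f (D (Suc i)) u \<in> ?J"
      unfolding row_app_def[of "r (Suc i)"]
      using cocycle by (intro ideal_span_sum ideal_span_mult_right) auto
    ultimately show "?g * row_app (r (Suc i)) c' (D (Suc i)) u \<in> ?J"
      using ideal_span_uminus by fastforce
  qed (use ik in simp)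
  show "\<not> (\<exists>e. \<forall>t<r (Suc i). c' t - coboundary (Suc i) e t \<in> ?J)"
  proof
    assume "\<exists>e. \<forall>t<r (Suc i). c' t - coboundary (Suc i) e t \<in> ?J"
    then obtain e where e: "\<And>t. t < r (Suc i) \<Longrightarrow> c' t - row_app (r i) e (D i) t \<in> ?J" by auto
    have "row_app (r i) (\<lambda>t. c t - ?g * e t) (D i) s \<in> ?J" if s: "s < r (Suc i)" for s
    proof -
      have "row_app (r i) (\<lambda>t. c t - ?g * e t) (D i) s =
          (row_app (r i) c (D i) s - ?g * c' s) + ?g * (c' s - row_app (r i) e (D i) s)"
        by (simp add: row_app_diff row_app_mult right_diff_distrib)
      then show ?thesis using cocycle[OF s] e[OF s] by (simp add: ideal_span_add ideal_span_mult)
    qed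
    \<comment> \<open>The corrected cochain is a cocycle modulo the smaller ideal, in a degree where
      Ext already vanishes. Its coboundary representation makes \<open>c\<close> trivial modulo the
      larger ideal, against \<open>nonzero\<close>.\<close>
    then have "\<exists>e'. \<forall>t<r i. c t - ?g * e t - coboundary i e' t \<in> ?J"
      using ik by (intro ext_vanishing[of q A p i k, OF reg AI]) simp_all
    then obtain e' where e': "\<And>t. t < r i \<Longrightarrow> c t - ?g * e t - coboundary i e' t \<in> ?J" by blast
    have "c t - coboundary i e' t \<in> ideal_span A (p + Suc k)" if "t < r i" for t
      unfolding add_Suc_right ideal_span_Suc_iff
      using e'[OF that] by (intro bexI[of _ "c t - ?g * e t - coboundary i e' t"] exI[of _ "e t"]) auto
    with nonzero show False by blast
  qed
qed

end

section \<open>A lower bound for the regularity\<close>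

lemma graded_maps_shift: "f \<in> graded_maps b a \<Longrightarrow> f \<in> graded_maps (b + k) (a + k)"
  by (auto simp: graded_maps_def)

lemma ideal_span_graded:
  fixes A :: "nat \<Rightarrow> ('v::finite, 'k::comm_ring_1) mpoly"
  assumes "\<And>j. j < k \<Longrightarrow> A j \<in> graded_maps (d j) 0" and "f \<in> ideal_span A k"
  shows "graded_part b a f \<in> ideal_span A k"
  using assms
proof (induction k arbitrary: f)
  case (Suc k)
  from Suc.prems(2) obtain h c where h: "h \<in> ideal_span A k" "f = h + A k * c"
    unfolding ideal_span_Suc_iff by blast
  have "A k \<in> graded_maps (d k + a) (0 + a)"
    by (intro graded_maps_shift Suc.prems(1)) simp
  then have "graded_part b a f = graded_part b a h + A k * graded_part b (d k + a) c"
    by (simp add: h graded_part_add graded_part_mult)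
  moreover have "graded_part b a h \<in> ideal_span A k"
    using h Suc by simp
  ultimately show ?case unfolding ideal_span_Suc_iff by blast
qed simp

text \<open>The \<open>p\<close> linear forms stay in the coefficient ideal throughout, and only the
  \<open>q\<close> quadrics, which lie in \<open>I\<close>, are removed. A nonzero class that
  survives all \<open>q\<close> removals has a nonzero entry on a generator of \<open>F_q\<close>,
  whose degree is therefore at least \<open>2 * q\<close>.\<close>

theorem le_reg:
  fixes I :: "('v::finite, 'k::field) mpoly set"
  assumes ideal: "0 \<in> I" "\<And>f g. f \<in> I \<Longrightarrow> g \<in> I \<Longrightarrow> f + g \<in> I" "\<And>f g. f \<in> I \<Longrightarrow> g * f \<in> I"
    and graded: "\<And>f b. f \<in> I \<Longrightarrow> graded_part b 0 f \<in> I"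
    and A_graded: "\<And>j. j < p \<Longrightarrow> A j \<in> graded_maps 1 0" "\<And>k. k < q \<Longrightarrow> A (p + k) \<in> graded_maps 2 0"
    and reg: "\<And>k f. k < q \<Longrightarrow> A (p + k) * f \<in> ideal_span A (p + k) \<Longrightarrow> f \<in> ideal_span A (p + k)"
    and AI: "\<And>k. k < q \<Longrightarrow> A (p + k) \<in> I"
    and IA: "I \<subseteq> ideal_span A (p + q)" and proper: "ideal_span A (p + q) \<subseteq> irrelevant_ideal"
  shows "int q \<le> reg I"
proof -
  define F where "F = (SOME F. minimal_graded_free_resolution F I)"
  have min: "minimal_graded_free_resolution F I"
    unfolding F_def by (rule someI_ex, rule minimal_resolution_exists)
      (use ideal graded IA proper in auto)
  then have F: "graded_free_resolution F I"
    by (simp add: minimal_graded_free_resolution_def)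
  define r where "r = rk F"
  define D where "D = diff_fun F"
  define \<epsilon> where "\<epsilon> = (\<lambda>t. aug F $ t)"
  have aug_carr: "aug F \<in> carrier_vec (r 0)"
    and aug_graded: "\<And>t. t < r 0 \<Longrightarrow> \<epsilon> t \<in> graded_maps (degs F 0 ! t) 0"
    and diff_graded: "\<And>i t s. t < r i \<Longrightarrow> s < r (Suc i) \<Longrightarrow> D i t s \<in> graded_maps (degs F (Suc i) ! s) (degs F i ! t)"
    using F by (auto simp: graded_free_resolution_def graded_maps_ok_def r_def \<epsilon>_def D_def diff_fun_def)
  have aug_vec: "aug F \<bullet> vec (r 0) v = (\<Sum>t<r 0. \<epsilon> t * v t)" for v
    using aug_carr by (simp add: scalar_prod_def \<epsilon>_def lessThan_atLeast0)
  have image0: "{v \<in> carrier_vec (r 0). aug F \<bullet> v \<in> I} = diff_image F 0"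
    using F by (simp add: graded_free_resolution_def r_def)
  interpret exact_complex r D I
  proof
    fix t i u assume t: "t < r i" and u: "u < r (Suc (Suc i))"
    define v where "v = (\<lambda>s. if s = u then 1 else 0 :: ('v, 'k) mpoly)"
    have "mat_app (r (Suc (Suc i))) (D (Suc i)) v s = D (Suc i) s u" for s
      using u by (simp add: mat_app_def v_def if_distrib sum.delta cong: if_cong)
    then show "mmul (r (Suc i)) (D i) (D (Suc i)) t u = 0"
      using diff_fun_complex[OF F, of t i v] t
      by (simp add: r_def D_def mmul_def mat_app_def[of "rk F (Suc i)"])
  next
    fix i v assume "\<And>t. t < r i \<Longrightarrow> (\<Sum>s<r (Suc i). D i t s * v s) = 0"
    then show "\<exists>w. \<forall>s<r (Suc i). v s = (\<Sum>u<r (Suc (Suc i)). D (Suc i) s u * w u)"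
      using diff_fun_exact[OF F, of i v] by (simp add: r_def D_def mat_app_def)
  next
    fix g t0 assume g: "g \<in> I" and t0: "t0 < r 0"
    define v where "v = (\<lambda>t. if t = t0 then g else 0)"
    have "aug F \<bullet> vec (r 0) v = \<epsilon> t0 * g"
      using t0 by (simp add: aug_vec v_def if_distrib sum.delta cong: if_cong)
    then have "vec (r 0) v \<in> diff_image F 0" using g ideal image0 by auto
    then obtain w where w: "w \<in> carrier_vec (r (Suc 0))" "vec (r 0) v = diff F 0 *\<^sub>v w"
      by (auto simp: diff_image_def r_def)
    have "vec (r (Suc 0)) (($) w) = w" by (rule vec_vec_index[OF w(1)])
    then have "v t = (\<Sum>u<r (Suc 0). D 0 t u * w $ u)" if "t < r 0" for t
      using mat_app_diff_fun[OF F, of t 0 "($) w"] w(2) that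
      by (simp add: r_def D_def mat_app_def flip: w(2))
    then show "\<exists>w. \<forall>t<r 0. (if t = t0 then g else 0) = (\<Sum>u<r (Suc 0). D 0 t u * w u)"
      unfolding v_def by blast
  qed
  \<comment> \<open>At stage \<open>i\<close> the last \<open>i\<close> quadrics have been removed
    from the ideal, and each of them has lowered the degree of the row by 2.\<close>
  have "\<exists>c. (\<forall>t<r i. c t \<in> graded_maps (degs F i ! t) (2 * i)) \<and>
      (\<forall>s<r (Suc i). row_app (r i) c (D i) s \<in> ideal_span A (p + (q - i))) \<and>
      \<not> (\<exists>e. \<forall>t<r i. c t - coboundary i e t \<in> ideal_span A (p + (q - i)))" if "i \<le> q" for i
    using that
  proof (induction i)
    case 0
    have "row_app (r 0) \<epsilon> (D 0) s \<in> I" if s: "s < r (Suc 0)" for s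
    proof -
      define v where "v = (\<lambda>u. if u = s then 1 else 0 :: ('v, 'k) mpoly)"
      let ?w = "diff F 0 *\<^sub>v vec (r (Suc 0)) v"
      have "?w \<in> diff_image F 0" by (auto simp: diff_image_def r_def)
      then have w: "?w \<in> carrier_vec (r 0)" "aug F \<bullet> ?w \<in> I" using image0 by auto
      have "?w $ t = D 0 t s" if "t < r 0" for t
        using mat_app_diff_fun[OF F, of t 0 v] that s
        by (simp add: r_def D_def mat_app_def v_def if_distrib sum.delta cong: if_cong)
      then have "row_app (r 0) \<epsilon> (D 0) s = aug F \<bullet> vec (r 0) (($) ?w)"
        by (simp only: row_app_def aug_vec) simp
      also have "vec (r 0) (($) ?w) = ?w" by (rule vec_vec_index[OF w(1)])
      finally have "row_app (r 0) \<epsilon> (D 0) s = aug F \<bullet> ?w" .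
      with w show ?thesis by simp
    qed
    \<comment> \<open>The augmentation reaches 1 modulo \<open>I\<close>, so its row cannot vanish
      modulo a proper ideal containing \<open>I\<close>.\<close>
    moreover have "\<not> (\<forall>t<r 0. \<epsilon> t \<in> ideal_span A (p + q))"
    proof
      assume *: "\<forall>t<r 0. \<epsilon> t \<in> ideal_span A (p + q)"
      obtain v where v: "v \<in> carrier_vec (r 0)" "aug F \<bullet> v - 1 \<in> I"
        using F unfolding graded_free_resolution_def r_def by blast
      have "vec (r 0) (($) v) = v" by (rule vec_vec_index[OF v(1)])
      then have "aug F \<bullet> v = (\<Sum>t<r 0. \<epsilon> t * v $ t)"
        using aug_vec[of "($) v"] by simp
      also have "\<dots> \<in> ideal_span A (p + q)"
        using * by (intro ideal_span_sum ideal_span_mult_right) auto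
      finally have "aug F \<bullet> v \<in> ideal_span A (p + q)" .
      from ideal_span_diff[OF this subsetD[OF IA v(2)]] have "1 \<in> ideal_span A (p + q)" by simp
      then show False using proper by (auto simp: irrelevant_ideal_def)
    qed
    ultimately show ?case
      using aug_graded IA by (intro exI[of _ \<epsilon>]) auto
  next
    case (Suc i)
    define k where "k = q - Suc i"
    have k: "i + Suc k = q" "q - i = Suc k" "k < q" using Suc.prems by (auto simp: k_def)
    obtain c where c: "\<And>t. t < r i \<Longrightarrow> c t \<in> graded_maps (degs F i ! t) (2 * i)"
      and cocycle: "\<And>s. s < r (Suc i) \<Longrightarrow> row_app (r i) c (D i) s \<in> ideal_span A (p + Suc k)"
      and nonzero: "\<not> (\<exists>e. \<forall>t<r i. c t - coboundary i e t \<in> ideal_span A (p + Suc k))"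
      using Suc.IH Suc.prems k(2) by auto
    have "\<exists>x\<in>graded_maps (degs F (Suc i) ! s) (2 * Suc i).
        row_app (r i) c (D i) s - A (p + k) * x \<in> ideal_span A (p + k)" if s: "s < r (Suc i)" for s
    proof -
      let ?f = "row_app (r i) c (D i) s" and ?b = "degs F (Suc i) ! s"
      obtain h x where hx: "h \<in> ideal_span A (p + k)" "?f = h + A (p + k) * x"
        using cocycle[OF s] unfolding add_Suc_right ideal_span_Suc_iff by blast
      have "?f \<in> graded_maps ?b (2 * i)"
        unfolding row_app_def using s by (intro graded_maps_sum graded_maps_mult[OF c diff_graded]) auto
      \<comment> \<open>The quotient \<open>x\<close> need not be homogeneous; passing to one degree
        in the whole equation replaces it by a homogeneous one.\<close>
      then have "?f = graded_part ?b (2 * i) h + graded_part ?b (2 * i) (A (p + k) * x)"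
        by (simp add: graded_part_id flip: graded_part_add hx(2))
      also have "graded_part ?b (2 * i) (A (p + k) * x) = A (p + k) * graded_part ?b (2 + 2 * i) x"
        using graded_maps_shift[OF A_graded(2)[OF k(3)], of "2 * i"] by (simp add: graded_part_mult)
      finally have "?f - A (p + k) * graded_part ?b (2 + 2 * i) x = graded_part ?b (2 * i) h" by simp
      moreover have "graded_part ?b (2 * i) h \<in> ideal_span A (p + k)"
      proof (rule ideal_span_graded[OF _ hx(1)])
        fix j assume "j < p + k"
        then show "A j \<in> graded_maps (if j < p then 1 else 2) 0"
          using A_graded(1)[of j] A_graded(2)[of "j - p"] k(3) by auto
      qed
      ultimately show ?thesis
        using graded_part_in[of ?b "2 + 2 * i" x] by (intro bexI[of _ "graded_part ?b (2 + 2 * i) x"]) simp_all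
    qed
    then have "\<forall>s. \<exists>x. s < r (Suc i) \<longrightarrow> x \<in> graded_maps (degs F (Suc i) ! s) (2 * Suc i) \<and>
        row_app (r i) c (D i) s - A (p + k) * x \<in> ideal_span A (p + k)" by blast
    from choice[OF this] obtain c' where
      c': "\<And>s. s < r (Suc i) \<Longrightarrow> c' s \<in> graded_maps (degs F (Suc i) ! s) (2 * Suc i)"
      "\<And>s. s < r (Suc i) \<Longrightarrow> row_app (r i) c (D i) s - A (p + k) * c' s \<in> ideal_span A (p + k)"
      by auto
    note * = ext_connecting[OF reg AI k(1) c'(2) nonzero]
    show ?case
      unfolding k_def[symmetric] using c'(1) *
      by (intro exI[of _ c'] conjI allI impI) simp_all
  qed
  from this[of q] obtain c where c: "\<And>t. t < r q \<Longrightarrow> c t \<in> graded_maps (degs F q ! t) (2 * q)"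
    and nonzero: "\<not> (\<exists>e. \<forall>t<r q. c t - coboundary q e t \<in> ideal_span A p)" by auto
  \<comment> \<open>Comparing with the zero coboundary shows that some entry of \<open>c\<close> is
    itself nonzero.\<close>
  have "coboundary q (\<lambda>_. 0) t = 0" for t by (cases q) simp_all
  then obtain t where t: "t < r q" "c t \<notin> ideal_span A p"
    using nonzero by (metis diff_zero)
  then obtain m where "m \<in> keys (c t)" using ideal_span_0 by fastforce
  then have deg: "2 * q \<le> degs F q ! t" using c[OF t(1)] by (auto simp: graded_maps_def)
  let ?S = "{int j - int i | i j. betti I i j \<noteq> 0}"
  have betti: "betti I i j \<noteq> 0 \<longleftrightarrow> j \<in> set (degs F i)" for i j
  proof -
    have "betti I i j = count_list (degs F i) j" unfolding betti_def F_def ..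
    then show ?thesis by (metis count_list_0_iff)
  qed
  \<comment> \<open>\<open>Max\<close> bounds its members only for a finite set; finiteness of the
    minimal resolution and of each list of degrees provides this.\<close>
  have "?S \<subseteq> (\<Union>i\<le>card (UNIV :: 'v set). (\<lambda>j. int j - int i) ` set (degs F i))"
  proof
    fix x assume "x \<in> ?S"
    then obtain i j where x: "x = int j - int i" and "betti I i j \<noteq> 0" by blast
    then have j: "j \<in> set (degs F i)" using betti by blast
    have "i \<le> card (UNIV :: 'v set)"
    proof (rule ccontr)
      assume "\<not> i \<le> card (UNIV :: 'v set)"
      then obtain k where "i = Suc k" "card (UNIV :: 'v set) \<le> k" by (cases i) auto
      with minimal_resolution_finite[OF min] j show False by (auto simp: rk_def)
    qed
    with j x show "x \<in> (\<Union>i\<le>card (UNIV :: 'v set). (\<lambda>j. int j - int i) ` set (degs F i))"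
      by blast
  qed
  then have fin: "finite ?S" by (rule finite_subset) simp
  have "degs F q ! t \<in> set (degs F q)" using t by (simp add: r_def rk_def)
  then have "int (degs F q ! t) - int q \<in> ?S" using betti by blast
  then have "int (degs F q ! t) - int q \<le> reg I" unfolding reg_def by (rule Max_ge[OF fin])
  with deg show ?thesis by linarith
qed


section \<open>Parity binomial edge ideals\<close>

lemma ideal_ring_of_type_algebra:
  fixes J :: "'a::comm_ring_1 set"
  shows "ideal J ring_of_type_algebra \<longleftrightarrow>
    0 \<in> J \<and> (\<forall>f\<in>J. \<forall>g\<in>J. f + g \<in> J) \<and> (\<forall>f\<in>J. \<forall>g. g * f \<in> J)"
proof
  assume "ideal J ring_of_type_algebra"
  then interpret J: ideal J ring_of_type_algebra .
  note J = additive_subgroup.zero_closed[OF J.additive_subgroup_axioms]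
    additive_subgroup.a_closed[OF J.additive_subgroup_axioms] J.I_l_closed
  show "0 \<in> J \<and> (\<forall>f\<in>J. \<forall>g\<in>J. f + g \<in> J) \<and> (\<forall>f\<in>J. \<forall>g. g * f \<in> J)"
    using J by (simp add: ring_of_type_algebra_def)
next
  interpret R: cring "ring_of_type_algebra :: 'a ring" by (rule cring_from_type_algebra)
  assume J: "0 \<in> J \<and> (\<forall>f\<in>J. \<forall>g\<in>J. f + g \<in> J) \<and> (\<forall>f\<in>J. \<forall>g. g * f \<in> J)"
  have minus: "\<ominus>\<^bsub>ring_of_type_algebra\<^esub> f = - f" for f :: 'a
    by (rule R.minus_equality) (simp_all add: ring_of_type_algebra_def)
  show "ideal J ring_of_type_algebra"
  proof (rule idealI)
    show "ring (ring_of_type_algebra :: 'a ring)" by (rule R.ring_axioms)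
    show "subgroup J (add_monoid (ring_of_type_algebra :: 'a ring))"
    proof
      fix f assume "f \<in> J"
      then have "- 1 * f \<in> J" using J by blast
      then show "inv\<^bsub>add_monoid ring_of_type_algebra\<^esub> f \<in> J"
        using minus[of f] by (simp add: a_inv_def)
    qed (use J in \<open>auto simp: ring_of_type_algebra_def\<close>)
  qed (use J in \<open>auto simp: ring_of_type_algebra_def mult.commute\<close>)
qed

definition edge_poly :: "'v \<Rightarrow> 'v \<Rightarrow> ('v + 'v, 'k::comm_ring_1) mpoly" where
  "edge_poly i j = var (Inl i) * var (Inl j) - var (Inr i) * var (Inr j)"

lemma edge_poly_commute: "edge_poly i j = edge_poly j i"
  by (simp add: edge_poly_def mult.commute)

lemma parity_ideal_eq:
  "parity_binomial_edge_ideal E = Idl\<^bsub>ring_of_type_algebra\<^esub> {edge_poly i j | i j. {i, j} \<in> E}"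
  by (simp add: parity_binomial_edge_ideal_def edge_poly_def)

lemma edge_poly_in_parity_ideal:
  "{i, j} \<in> E \<Longrightarrow> (edge_poly i j :: ('v + 'v, 'k::comm_ring_1) mpoly) \<in> parity_binomial_edge_ideal E"
  unfolding parity_ideal_eq
  using ring.genideal_self[OF ring_from_type_algebra, of "{edge_poly i j | i j. {i, j} \<in> E}"]
  by (auto simp: ring_of_type_algebra_def)

lemma parity_ideal_subsetI:
  fixes J :: "('v + 'v, 'k::comm_ring_1) mpoly set"
  assumes "0 \<in> J" "\<And>f g. f \<in> J \<Longrightarrow> g \<in> J \<Longrightarrow> f + g \<in> J" "\<And>f g. f \<in> J \<Longrightarrow> g * f \<in> J"
    and "\<And>i j. {i, j} \<in> E \<Longrightarrow> edge_poly i j \<in> J"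
  shows "parity_binomial_edge_ideal E \<subseteq> J"
  unfolding parity_ideal_eq
  using assms by (intro ring.genideal_minimal[OF ring_from_type_algebra])
    (auto simp: ideal_ring_of_type_algebra)

lemma parity_ideal_closed:
  fixes E :: "'v set set"
  defines "I \<equiv> parity_binomial_edge_ideal E :: ('v + 'v, 'k::comm_ring_1) mpoly set"
  shows "0 \<in> I" "f \<in> I \<Longrightarrow> g \<in> I \<Longrightarrow> f + g \<in> I" "f \<in> I \<Longrightarrow> h * f \<in> I" "f \<in> I \<Longrightarrow> f * h \<in> I"
    "f \<in> I \<Longrightarrow> g \<in> I \<Longrightarrow> f - g \<in> I"
proof -
  have "ideal I ring_of_type_algebra"
    unfolding I_def parity_ideal_eq
    by (rule ring.genideal_ideal[OF ring_from_type_algebra]) (simp add: ring_of_type_algebra_def)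
  then show "0 \<in> I" and add: "\<And>f g. f \<in> I \<Longrightarrow> g \<in> I \<Longrightarrow> f + g \<in> I"
    and mult: "\<And>f h. f \<in> I \<Longrightarrow> h * f \<in> I"
    by (simp_all add: ideal_ring_of_type_algebra)
  show "f \<in> I \<Longrightarrow> f * h \<in> I" using mult[of f h] by (simp add: mult.commute)
  show "f \<in> I \<Longrightarrow> g \<in> I \<Longrightarrow> f - g \<in> I" using add[of f "- 1 * g"] mult[of g "- 1"] by simp
qed

lemma edge_poly_graded: "(edge_poly i j :: ('v::finite + 'v, 'k::comm_ring_1) mpoly) \<in> graded_maps 2 0"
  unfolding edge_poly_def var_mult by (intro graded_maps_minus graded_maps_single) simp_all

text \<open>The polynomials whose parts all lie in the ideal form an ideal containing the
  generators. Both indices are quantified because multiplication by a monomial shifts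
  \<open>a\<close>.\<close>

lemma graded_part_parity_ideal:
  fixes E :: "'v::finite set set"
  assumes "f \<in> (parity_binomial_edge_ideal E :: ('v + 'v, 'k::comm_ring_1) mpoly set)"
  shows "graded_part b a f \<in> parity_binomial_edge_ideal E"
proof -
  let ?I = "parity_binomial_edge_ideal E :: ('v + 'v, 'k) mpoly set"
  have "?I \<subseteq> {f. \<forall>b a. graded_part b a f \<in> ?I}"
  proof (rule parity_ideal_subsetI; clarify?)
    fix f g :: "('v + 'v, 'k) mpoly" and b a
    assume f: "\<forall>b a. graded_part b a f \<in> ?I"
    show "graded_part b a (g * f) \<in> ?I"
    proof (induction g rule: poly_mapping_additive_induct)
      case (single m c)
      have "Poly_Mapping.single m c \<in> graded_maps (mon_deg m + a) a"
        by (rule graded_maps_single) simp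
      then show ?case using f by (simp add: graded_part_mult parity_ideal_closed)
    qed (simp_all add: parity_ideal_closed distrib_right graded_part_add)
  next
    fix i j b a assume "{i, j} \<in> E"
    then have "edge_poly i j \<in> ?I" by (rule edge_poly_in_parity_ideal)
    moreover have "(edge_poly i j :: ('v + 'v, 'k) mpoly) \<in> graded_maps (2 + a) a"
      using graded_maps_shift[OF edge_poly_graded, of i j a] by simp
    then have "graded_part b a (edge_poly i j) = (if b = 2 + a then edge_poly i j else 0 :: ('v + 'v, 'k) mpoly)"
      by (intro poly_mapping_eqI) (auto simp: graded_maps_def lookup_graded_part Poly_Mapping.in_keys_iff)
    ultimately show "graded_part b a (edge_poly i j) \<in> ?I" by (simp add: parity_ideal_closed)
  qed (simp_all add: parity_ideal_closed graded_part_add)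
  with assms show ?thesis by blast
qed

text \<open>\<open>fold_vars\<close> is the substitution \<open>x\<^sub>i \<mapsto> y\<^sub>i\<close>, whose kernel is the prime \<open>(x\<^sub>i - y\<^sub>i : i)\<close>.\<close>

definition fold_mon :: "('v::finite + 'v \<Rightarrow>\<^sub>0 nat) \<Rightarrow> ('v + 'v \<Rightarrow>\<^sub>0 nat)" where
  "fold_mon m = (\<Sum>p\<in>UNIV. Poly_Mapping.single (Inr p) (lookup m (Inl p) + lookup m (Inr p)))"

definition fold_vars :: "('v::finite + 'v, 'k::comm_ring_1) mpoly \<Rightarrow> ('v + 'v, 'k) mpoly" where
  "fold_vars = push fold_mon"

lemma fold_mon_add: "fold_mon (a + b) = fold_mon a + fold_mon b"
  by (simp add: fold_mon_def lookup_add single_add sum.distrib algebra_simps)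

lemma fold_vars_add: "fold_vars (f + g) = fold_vars f + fold_vars g"
  by (simp add: fold_vars_def push_add)

lemma fold_vars_mult: "fold_vars (f * g) = fold_vars f * fold_vars g"
  by (simp add: fold_vars_def push_mult fold_mon_add)

lemma fold_vars_1: "fold_vars 1 = 1"
proof -
  have "fold_vars (Poly_Mapping.single 0 1) = Poly_Mapping.single (fold_mon 0) 1"
    by (simp only: fold_vars_def push_single)
  then show ?thesis by (simp add: fold_mon_def)
qed

lemma fold_mon_single:
  "fold_mon (Poly_Mapping.single (Inl p) k) = Poly_Mapping.single (Inr p) k"
  "fold_mon (Poly_Mapping.single (Inr p) k) = Poly_Mapping.single (Inr p) k"
proof -
  have *: "(\<Sum>q\<in>UNIV. Poly_Mapping.single (Inr q) (if p = q then k else 0)) = Poly_Mapping.single (Inr p) k"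
    by (simp add: if_distrib sum.delta cong: if_cong)
  show "fold_mon (Poly_Mapping.single (Inl p) k) = Poly_Mapping.single (Inr p) k"
    "fold_mon (Poly_Mapping.single (Inr p) k) = Poly_Mapping.single (Inr p) k"
    using * by (simp_all add: fold_mon_def lookup_single when_def)
qed

lemma fold_vars_var: "fold_vars (var (Inl p)) = var (Inr p)" "fold_vars (var (Inr p)) = var (Inr p)"
  by (simp_all add: fold_vars_def var_def fold_mon_single)

text \<open>One factor x_p is exchanged for y_p at a time, so the total x-degree serves as induction
  measure.\<close>

lemma single_fold_mon_cong:
  fixes Q :: "('v::finite + 'v, 'k::comm_ring_1) mpoly set"
  assumes Q: "0 \<in> Q" "\<And>f g. f \<in> Q \<Longrightarrow> g \<in> Q \<Longrightarrow> f + g \<in> Q" "\<And>f g. f \<in> Q \<Longrightarrow> g * f \<in> Q"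
    and gens: "\<And>p. var (Inl p) - var (Inr p) \<in> Q"
  shows "Poly_Mapping.single m c - Poly_Mapping.single (fold_mon m) c \<in> Q"
proof (induction "\<Sum>p\<in>UNIV. lookup m (Inl p)" arbitrary: m rule: less_induct)
  case less
  show ?case
  proof (cases "\<exists>p. lookup m (Inl p) \<noteq> 0")
    case False
    have "lookup (fold_mon m) v = lookup m v" for v
      using False by (cases v) (auto simp: fold_mon_def lookup_sum lookup_single when_def sum.delta)
    then have "fold_mon m = m" by (rule poly_mapping_eqI)
    then show ?thesis by (simp add: Q)
  next
    case True
    then obtain p where p: "lookup m (Inl p) \<noteq> 0" by blast
    define m0 where "m0 = m - Poly_Mapping.single (Inl p) 1"
    have m: "m = m0 + Poly_Mapping.single (Inl p) 1"
      using p by (intro poly_mapping_eqI) (auto simp: m0_def lookup_add lookup_minus lookup_single when_def)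
    define m' where "m' = m0 + Poly_Mapping.single (Inr p) 1"
    have "(\<Sum>q\<in>UNIV. lookup m' (Inl q)) < (\<Sum>q\<in>UNIV. lookup m (Inl q))"
      by (rule sum_strict_mono_ex1) (auto simp: m m'_def lookup_add lookup_single intro!: exI[of _ p])
    then have "Poly_Mapping.single m' c - Poly_Mapping.single (fold_mon m') c \<in> Q" by (rule less)
    moreover have "fold_mon m' = fold_mon m" by (simp add: m m'_def fold_mon_add fold_mon_single)
    moreover have "Poly_Mapping.single m0 c * (var (Inl p) - var (Inr p)) \<in> Q" by (intro Q gens)
    ultimately have "Poly_Mapping.single m0 c * (var (Inl p) - var (Inr p)) +
        (Poly_Mapping.single m' c - Poly_Mapping.single (fold_mon m) c) \<in> Q"
      by (intro Q(2)) simp_all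
    moreover have "Poly_Mapping.single m0 c * (var (Inl p) - var (Inr p)) =
        Poly_Mapping.single m c - Poly_Mapping.single m' c"
      by (simp add: m m'_def var_def right_diff_distrib mult_single)
    ultimately show ?thesis by simp
  qed
qed

lemma fold_vars_cong:
  fixes Q :: "('v::finite + 'v, 'k::comm_ring_1) mpoly set"
  assumes Q: "0 \<in> Q" "\<And>f g. f \<in> Q \<Longrightarrow> g \<in> Q \<Longrightarrow> f + g \<in> Q" "\<And>f g. f \<in> Q \<Longrightarrow> g * f \<in> Q"
    and gens: "\<And>p. var (Inl p) - var (Inr p) \<in> Q"
  shows "f - fold_vars f \<in> Q"
proof (induction f rule: poly_mapping_additive_induct)
  case (add f g)
  then have "(f - fold_vars f) + (g - fold_vars g) \<in> Q" by (rule Q)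
  then show ?case by (simp add: fold_vars_add algebra_simps)
next
  case (single m c)
  show ?case using single_fold_mon_cong[OF Q gens, of m c] by (simp add: fold_vars_def)
qed (simp add: Q fold_vars_def)

lemma fold_vars_parity_ideal:
  fixes E :: "'v::finite set set"
  assumes "f \<in> (parity_binomial_edge_ideal E :: ('v + 'v, 'k::comm_ring_1) mpoly set)"
  shows "fold_vars f = 0"
proof -
  have "fold_vars (edge_poly i j :: ('v + 'v, 'k) mpoly) = 0" for i j
    using fold_vars_add[of "edge_poly i j :: ('v + 'v, 'k) mpoly" "var (Inr i) * var (Inr j)"]
    by (simp add: edge_poly_def fold_vars_mult fold_vars_var)
  then have "parity_binomial_edge_ideal E \<subseteq> {f :: ('v + 'v, 'k) mpoly. fold_vars f = 0}"
    by (intro parity_ideal_subsetI) (auto simp: fold_vars_add fold_vars_mult, simp add: fold_vars_def)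
  with assms show ?thesis by blast
qed

lemma primeideal_fold_vars:
  "primeideal {f :: ('v::finite + 'v, 'k::field) mpoly. fold_vars f = 0} ring_of_type_algebra"
proof (rule primeidealI)
  show "ideal {f :: ('v + 'v, 'k) mpoly. fold_vars f = 0} ring_of_type_algebra"
    unfolding ideal_ring_of_type_algebra
    by (auto simp: fold_vars_add fold_vars_mult, simp add: fold_vars_def)
  have "(1 :: ('v + 'v, 'k) mpoly) \<notin> {f. fold_vars f = 0}" by (simp add: fold_vars_1)
  then show "carrier ring_of_type_algebra \<noteq> {f :: ('v + 'v, 'k) mpoly. fold_vars f = 0}"
    unfolding ring_of_type_algebra_def by auto
  show "cring (ring_of_type_algebra :: ('v + 'v, 'k) mpoly ring)" by (rule cring_from_type_algebra)
qed (auto simp: ring_of_type_algebra_def fold_vars_mult dest: mpoly_no_zero_divisors)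

lemma v_number_le:
  fixes E :: "'v::finite set set" and f :: "('v + 'v, 'k::field) mpoly"
  defines "I \<equiv> parity_binomial_edge_ideal E"
  assumes hom: "f \<in> hom_component d" and f: "fold_vars f \<noteq> 0"
    and kill: "\<And>p. (var (Inl p) - var (Inr p)) * f \<in> I"
  shows "v_number I \<le> d"
proof -
  have "colon I f = {h. fold_vars h = 0}"
  proof (intro equalityI subsetI; simp add: colon_def)
    fix h assume "h * f \<in> I"
    then have "fold_vars h * fold_vars f = 0"
      unfolding I_def fold_vars_mult[symmetric] by (rule fold_vars_parity_ideal)
    then show "fold_vars h = 0" using f mpoly_no_zero_divisors by blast
  next
    fix h :: "('v + 'v, 'k) mpoly" assume h: "fold_vars h = 0"
    have "h - fold_vars h \<in> {h. h * f \<in> I}"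
      by (rule fold_vars_cong)
        (auto simp: I_def parity_ideal_closed distrib_right mult.assoc kill[unfolded I_def])
    with h show "h * f \<in> I" by simp
  qed
  then have "colon I f \<in> Ass I"
    using primeideal_fold_vars by (auto simp: Ass_def)
  then show ?thesis unfolding v_number_def using hom by (intro Least_le) blast
qed


section \<open>Odd cycles with a chord\<close>

text \<open>The two arcs between the ends of the chord have lengths with odd sum \<open>n\<close>,
  so exactly one is even; rotating the numbering starts that arc at 0. The other arc has odd length
  \<open>n - L\<close>, and length 1 would make the chord an edge of the cycle.\<close>

lemma cycle_with_chord:
  assumes "cycle_graph n C" "odd n" "a \<noteq> b" "{a, b} \<notin> C"
  obtains d L where "bij_betw d {0..<n} UNIV" "C = {{d i, d (Suc i mod n)} | i. i < n}"
    "{a, b} = {d 0, d L}" "even L" "2 \<le> L" "L + 3 \<le> n"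
proof -
  note result = that
  from assms(1) obtain c where n: "3 \<le> n" and c: "bij_betw c {0..<n} UNIV"
    and C: "C = {{c i, c (Suc i mod n)} | i. i < n}"
    unfolding cycle_graph_def by blast
  have rotate: "bij_betw (\<lambda>i. c ((k + i) mod n)) {0..<n} UNIV"
    "C = {{c ((k + i) mod n), c ((k + Suc i mod n) mod n)} | i. i < n}" for k
  proof -
    define \<rho> where "\<rho> = (\<lambda>i. (k + i) mod n)"
    have "inj_on \<rho> {0..<n}"
    proof (rule inj_onI)
      fix i j assume ij: "i \<in> {0..<n}" "j \<in> {0..<n}" "\<rho> i = \<rho> j"
      have False if "i < j" "j < n" "\<rho> i = \<rho> j" for i j
        using that mod_eq_dvd_iff_nat[where m = "k + j" and n = "k + i" and q = n] dvd_imp_le[of n "j - i"]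
        by (simp add: \<rho>_def)
      from this[of i j] this[of j i] ij show "i = j" by (metis atLeastLessThan_iff linorder_neqE_nat)
    qed
    moreover have sub: "\<rho> ` {0..<n} \<subseteq> {0..<n}" using n by (auto simp: \<rho>_def)
    ultimately have \<rho>: "\<rho> ` {0..<n} = {0..<n}" by (intro card_subset_eq) (auto simp: card_image)
    then have "bij_betw \<rho> {0..<n} {0..<n}" using \<open>inj_on \<rho> _\<close> by (simp add: bij_betw_def)
    from bij_betw_trans[OF this c] show "bij_betw (\<lambda>i. c ((k + i) mod n)) {0..<n} UNIV"
      by (simp add: comp_def \<rho>_def)
    have "C = (\<lambda>i. {c i, c (Suc i mod n)}) ` \<rho> ` {0..<n}" unfolding \<rho> C by auto
    also have "\<dots> = {{c ((k + i) mod n), c ((k + Suc i mod n) mod n)} | i. i < n}"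
      by (auto simp: \<rho>_def mod_simps)
    finally show "C = {{c ((k + i) mod n), c ((k + Suc i mod n) mod n)} | i. i < n}" .
  qed
  obtain i0 j0 where ij: "i0 < n" "a = c i0" "j0 < n" "b = c j0"
    using c by (metis UNIV_I atLeastLessThan_iff bij_betw_def imageE)
  then have "i0 \<noteq> j0" using assms(3) by auto
  define dist where "dist = (\<lambda>i j. if i \<le> j then j - i else n + j - i :: nat)"
  have found: thesis if "i < n" "j < n" "i \<noteq> j" "{a, b} = {c i, c j}" "even (dist i j)" for i j
  proof -
    define d where "d = (\<lambda>t. c ((i + t) mod n))"
    have "(i + dist i j) mod n = j" using that(1,2) by (auto simp: dist_def)
    then have ends: "d 0 = c i" "d (dist i j) = c j" using that(1) by (simp_all add: d_def)
    have Cd: "C = {{d i, d (Suc i mod n)} | i. i < n}" unfolding d_def by (rule rotate)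
    have lt: "dist i j < n" "dist i j \<noteq> 0" using that by (auto simp: dist_def)
    have "dist i j \<noteq> n - 1"
    proof
      assume "dist i j = n - 1"
      then have "{c j, c i} \<in> C"
        unfolding Cd using n ends by (intro CollectI exI[of _ "dist i j"]) auto
      then show False using assms(4) that(4) by (simp add: insert_commute)
    qed
    moreover have "dist i j \<noteq> n - 2" using assms(2) n that(5) by auto
    moreover have "dist i j \<noteq> 1" using that(5) by auto
    ultimately have "2 \<le> dist i j" "dist i j + 3 \<le> n" using lt by auto
    then show thesis
      using that(4,5) rotate(1)[of i] Cd ends
      by (intro result[of d "dist i j"]) (auto simp: d_def)
  qed
  have "dist i0 j0 + dist j0 i0 = n" using ij \<open>i0 \<noteq> j0\<close> by (auto simp: dist_def)
  then consider "even (dist i0 j0)" | "even (dist j0 i0)" using assms(2) by (metis even_add)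
  then show thesis
  proof cases
    case 1
    then show ?thesis using found[of i0 j0] ij \<open>i0 \<noteq> j0\<close> by simp
  next
    case 2
    then show ?thesis using found[of j0 i0] ij \<open>i0 \<noteq> j0\<close> by (simp add: insert_commute)
  qed
qed

lemma prod_linear_graded:
  fixes w :: "'i \<Rightarrow> ('v::finite, 'k::comm_ring_1) mpoly"
  assumes "finite T" "\<And>i. i \<in> T \<Longrightarrow> w i \<in> graded_maps 1 0"
  shows "prod w T \<in> graded_maps (card T) 0"
  using assms
proof (induction T rule: finite_induct)
  case empty
  then show ?case by (simp add: graded_maps_def)
next
  case (insert i T)
  then have "prod w T \<in> graded_maps (card T + 1) (0 + 1)" by (intro graded_maps_shift) simp
  moreover have "w i \<in> graded_maps 1 0" by (rule insert) simp
  ultimately have "w i * prod w T \<in> graded_maps (card T + 1) 0" by (simp add: graded_maps_mult)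
  then show ?case using insert by simp
qed

lemma fold_vars_prod_neq_0:
  fixes w :: "'i \<Rightarrow> ('v::finite + 'v, 'k::field) mpoly"
  assumes "finite T" "\<And>i. i \<in> T \<Longrightarrow> fold_vars (w i) \<noteq> 0"
  shows "fold_vars (prod w T) \<noteq> 0"
  using assms
proof (induction T rule: finite_induct)
  case empty
  show ?case by (simp add: fold_vars_1)
next
  case (insert i T)
  then show ?case by (auto simp: fold_vars_mult dest: mpoly_no_zero_divisors)
qed

text \<open>With \<open>u\<^sub>i = x\<^sub>i - y\<^sub>i\<close> and \<open>w\<^sub>i = x\<^sub>i + y\<^sub>i\<close> the generators become \<open>u\<^sub>i w\<^sub>j + w\<^sub>i u\<^sub>j\<close>, so along an
  edge \<open>u\<^sub>i \<Prod>\<^bsub>k\<noteq>i\<^esub> w\<^sub>k\<close> changes its sign modulo the ideal. Going once around the odd cycle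
  \<open>0, \<dots>, L\<close> shows that twice this element is in the ideal.\<close>

lemma v_number_le_cycle_chord:
  fixes E :: "'v::finite set set"
  defines "I \<equiv> parity_binomial_edge_ideal E :: ('v + 'v, 'k::field) mpoly set"
  assumes two: "(2::'k) \<noteq> 0"
    and surj: "\<And>p. \<exists>i<n. p = d i"
    and path: "\<And>i. Suc i < n \<Longrightarrow> {d i, d (Suc i)} \<in> E"
    and last: "{d 0, d (n - 1)} \<in> E" and chord: "{d 0, d L} \<in> E"
    and L: "even L" "2 \<le> L" "L + 3 \<le> n"
  shows "v_number I \<le> n - 2"
proof -
  define u where "u = (\<lambda>i. var (Inl (d i)) - var (Inr (d i)) :: ('v + 'v, 'k) mpoly)"
  define w where "w = (\<lambda>i. var (Inl (d i)) + var (Inr (d i)) :: ('v + 'v, 'k) mpoly)"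
  \<comment> \<open>\<open>T\<close> omits the last two vertices. The bound
    \<open>L + 3 \<le> n\<close> keeps the whole odd cycle \<open>0, ..., L\<close> inside
    \<open>T\<close>.\<close>
  define T where "T = {..<n - 2}"
  define U where "U = (\<lambda>i. u i * prod w (T - {i}))"
  note closed = parity_ideal_closed[where E = E and 'k = 'k, folded I_def]
  have fin: "finite T" by (simp add: T_def)
  have uw: "u i * w j + w i * u j \<in> I" if "{d i, d j} \<in> E" for i j
  proof -
    have "edge_poly (d i) (d j) \<in> I" unfolding I_def by (rule edge_poly_in_parity_ideal) fact
    then have "edge_poly (d i) (d j) + edge_poly (d i) (d j) \<in> I" by (intro closed)
    then show ?thesis by (simp add: edge_poly_def u_def w_def algebra_simps)
  qed
  have U_edge: "U i + U j \<in> I" if "i \<in> T" "j \<in> T" "i \<noteq> j" "{d i, d j} \<in> E" for i j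
  proof -
    have "prod w (T - {i}) = w j * prod w (T - {i} - {j})" "prod w (T - {j}) = w i * prod w (T - {j} - {i})"
      using that fin by (auto intro!: prod.remove)
    moreover have "T - {j} - {i} = T - {i} - {j}" by blast
    ultimately have "U i + U j = (u i * w j + w i * u j) * prod w (T - {i} - {j})"
      by (simp add: U_def algebra_simps)
    then show ?thesis using uw[OF that(4)] closed(4) by simp
  qed
  have alternate: "U i - (- 1) ^ i * U 0 \<in> I" if "i < n - 2" for i
    using that
  proof (induction i)
    case (Suc i)
    have "U i + U (Suc i) \<in> I" "U i - (- 1) ^ i * U 0 \<in> I"
      using Suc path[of i] by (auto simp: T_def intro: U_edge)
    then have "(U i + U (Suc i)) - (U i - (- 1) ^ i * U 0) \<in> I" by (rule closed(5))
    then show ?case by simp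
  qed (simp add: closed)
  \<comment> \<open>Along the even path \<open>U L\<close> agrees with \<open>U 0\<close>, across
    the chord with \<open>- U 0\<close>.\<close>
  have "U 0 + U L \<in> I" by (rule U_edge) (use L chord in \<open>auto simp: T_def\<close>)
  moreover have "U L - (- 1) ^ L * U 0 \<in> I" by (rule alternate) (use L in simp)
  ultimately have "(U 0 + U L) - (U L - (- 1) ^ L * U 0) \<in> I" by (rule closed(5))
  then have "Poly_Mapping.single 0 (inverse 2) * (2 * U 0) \<in> I"
    using L(1) by (intro closed(3)[of "2 * U 0"]) simp
  also have "Poly_Mapping.single 0 (inverse 2) * (2 * U 0) =
      Poly_Mapping.single 0 (inverse 2) * Poly_Mapping.single 0 2 * U 0"
    by (simp add: mult.assoc)
  also have "\<dots> = U 0" using two by (simp only: mult_single) simp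
  finally have U0: "U 0 \<in> I" .
  have U: "U i \<in> I" if "i \<in> T" for i
  proof -
    have "U i - (- 1) ^ i * U 0 + (- 1) ^ i * U 0 \<in> I"
      using that by (intro closed alternate U0) (simp add: T_def)
    then show ?thesis by simp
  qed
  have boundary: "u j * prod w T \<in> I" if "i \<in> T" "{d j, d i} \<in> E" for i j
  proof -
    have "u j * prod w T = (u j * w i + w j * u i) * prod w (T - {i}) - w j * U i"
      using that(1) fin by (simp add: U_def prod.remove[of T i] algebra_simps)
    then show ?thesis using uw[OF that(2)] U[OF that(1)] by (simp add: closed)
  qed
  have "u j * prod w T \<in> I" if "j < n" for j
  proof -
    \<comment> \<open>The omitted vertices have neighbours in \<open>T\<close>: \<open>n - 3\<close>
      for \<open>n - 2\<close>, and \<open>0\<close> for \<open>n - 1\<close>.\<close>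
    have "j \<in> T \<or> j = n - 2 \<or> j = n - 1" using that by (auto simp: T_def)
    then consider "j \<in> T" | "j = n - 2" | "j = n - 1" by blast
    then show ?thesis
    proof cases
      case 1
      then have "u j * prod w T = w j * U j" using fin by (simp add: U_def prod.remove[of T j] algebra_simps)
      then show ?thesis using U[OF 1] by (simp add: closed)
    next
      case 2
      moreover have "{d (n - 3), d (n - 2)} \<in> E" using path[of "n - 3"] L by (simp add: numeral_eq_Suc Suc_diff_Suc)
      ultimately show ?thesis using L by (intro boundary[of "n - 3"]) (auto simp: T_def insert_commute)
    next
      case 3
      then show ?thesis using L last by (intro boundary[of 0]) (auto simp: T_def insert_commute)
    qed
  qed
  then have "(var (Inl p) - var (Inr p)) * prod w T \<in> I" for p
    using surj[of p] by (auto simp: u_def)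
  moreover have "prod w T \<in> hom_component (n - 2)"
  proof -
    have "prod w T \<in> graded_maps (card T) 0"
      unfolding w_def var_def using fin
      by (intro prod_linear_graded graded_maps_add graded_maps_single) simp_all
    then show ?thesis by (simp add: graded_maps_def hom_component_def T_def)
  qed
  moreover have "fold_vars (w i) \<noteq> 0" for i
  proof -
    have "fold_vars (w i) = var (Inr (d i)) + var (Inr (d i))"
      by (simp add: w_def fold_vars_add fold_vars_var)
    then have "lookup (fold_vars (w i)) (Poly_Mapping.single (Inr (d i)) 1) = 2"
      by (simp add: var_def flip: single_add)
    then show ?thesis using two by auto
  qed
  then have "fold_vars (prod w T) \<noteq> 0" using fin by (intro fold_vars_prod_neq_0)
  ultimately show ?thesis unfolding I_def by (intro v_number_le)
qed

text \<open>Deleting the vertex \<open>d 0\<close> of the chord leaves the path \<open>d 1, \<dots>, d (n - 1)\<close>. For the weights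
  below, the edge binomial of \<open>d j\<close> and \<open>d (j + 1)\<close> has the leading term \<open>z\<^sub>j z'\<^sub>j\<^sub>+\<^sub>1\<close>, where
  \<open>(z\<^sub>j, z'\<^sub>j)\<close> is \<open>(x\<^sub>j, y\<^sub>j)\<close> for odd and \<open>(y\<^sub>j, x\<^sub>j)\<close> for even \<open>j\<close>.\<close>

lemma le_reg_cycle_chord:
  fixes E :: "'v::finite set set"
  defines "I \<equiv> parity_binomial_edge_ideal E :: ('v + 'v, 'k::field) mpoly set"
  assumes d: "bij_betw d {0..<n} UNIV" and n: "2 \<le> n"
    and E: "\<And>i j. i < n \<Longrightarrow> j < n \<Longrightarrow> {d i, d j} \<in> E \<Longrightarrow> i = 0 \<or> j = 0 \<or> j = Suc i \<or> i = Suc j"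
    and path: "\<And>i. Suc i < n \<Longrightarrow> {d i, d (Suc i)} \<in> E"
  shows "int (n - 2) \<le> reg I"
proof -
  define z where "z = (\<lambda>j. if odd j then Inl (d j) else Inr (d j))"
  define z' where "z' = (\<lambda>j. if odd j then Inr (d j) else Inl (d j))"
  have inj: "d i = d j \<longleftrightarrow> i = j" if "i < n" "j < n" for i j
    using d that by (auto simp: bij_betw_def inj_on_def)
  have zz: "z i = z j \<longleftrightarrow> i = j" "z' i = z' j \<longleftrightarrow> i = j" "z i \<noteq> z' j" "z' j \<noteq> z i" if "i < n" "j < n" for i j
    using inj[OF that] by (auto simp: z_def z'_def)
  \<comment> \<open>Exchanging x and y at every other vertex changes edge binomials only by a sign,
    but lets an edge use \<open>z\<close> of its first and \<open>z'\<close> of its second vertex in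
    the leading term, so that neighbouring edges share no variable there.\<close>
  define g where "g = (\<lambda>j. var (z j) * var (z' (Suc j)) - var (z' j) * var (z (Suc j)) :: ('v + 'v, 'k) mpoly)"
  have g: "g j = edge_poly (d j) (d (Suc j)) \<or> g j = - edge_poly (d j) (d (Suc j))" for j
    by (cases "odd j") (simp_all add: g_def z_def z'_def edge_poly_def)
  \<comment> \<open>The variables of \<open>d 0\<close> come first, in this order, so that
    \<open>lm k\<close> involves only \<open>z (k - 1)\<close> and \<open>z' k\<close>; this makes
    the supports disjoint.\<close>
  define A where "A = (\<lambda>k. if k = 0 then var (z' 0) else if k = 1 then var (z 0) else g (k - 1))"
  define lm where "lm = (\<lambda>k. if k = 0 then Poly_Mapping.single (z' 0) 1 else
      if k = 1 then Poly_Mapping.single (z 0) 1 else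
      Poly_Mapping.single (z (k - 1)) 1 + Poly_Mapping.single (z' k) (1::nat))"
  define idx where "idx = inv_into {0..<n} d"
  have idx: "idx (d i) = i" if "i < n" for i
    using d that by (auto simp: idx_def bij_betw_def intro!: inv_into_f_f)
  \<comment> \<open>Weight \<open>n - j\<close> on \<open>z j\<close> and 0 on \<open>z' j\<close>:
    the two monomials of \<open>g j\<close> then weigh \<open>n - j\<close> and
    \<open>n - j - 1\<close>.\<close>
  define wt where "wt = (\<lambda>v. case v of Inl p \<Rightarrow> if odd (idx p) then n - idx p else 0
      | Inr p \<Rightarrow> if even (idx p) then n - idx p else 0)"
  have wt: "wt (z i) = n - i" "wt (z' i) = 0" if "i < n" for i
    using idx[OF that] by (auto simp: wt_def z_def z'_def)
  define \<omega> where "\<omega> = (\<lambda>m :: 'v + 'v \<Rightarrow>\<^sub>0 nat. \<Sum>v\<in>UNIV. lookup m v * wt v)"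
  have \<omega>_add: "\<omega> (a + b) = \<omega> a + \<omega> b" for a b
    by (simp add: \<omega>_def lookup_add distrib_right sum.distrib)
  have \<omega>_single: "\<omega> (Poly_Mapping.single v 1) = wt v" for v
  proof -
    have "\<omega> (Poly_Mapping.single v 1) = (\<Sum>x\<in>UNIV. if v = x then wt x else 0)"
      unfolding \<omega>_def by (intro sum.cong) (auto simp: lookup_single)
    then show ?thesis by simp
  qed
  interpret coprime_leads A lm \<omega> n
  proof
    fix k m assume k: "k < n" and m: "m \<in> keys (A k - Poly_Mapping.single (lm k) 1)"
    show "\<omega> m < \<omega> (lm k)"
    proof (cases "k < 2")
      case True
      then have "A k = Poly_Mapping.single (lm k) 1" by (cases k) (auto simp: A_def lm_def var_def)
      with m show ?thesis by simp
    next
      case False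
      then obtain j where j: "k = Suc j" "0 < j" by (cases k) auto
      have "A k - Poly_Mapping.single (lm k) 1 =
          - Poly_Mapping.single (Poly_Mapping.single (z' j) 1 + Poly_Mapping.single (z (Suc j)) 1) 1"
        using j by (simp add: A_def lm_def g_def var_mult)
      with m have "m = Poly_Mapping.single (z' j) 1 + Poly_Mapping.single (z (Suc j)) 1"
        by (simp flip: single_uminus)
      then have "\<omega> m = n - Suc j" using j k by (simp add: \<omega>_add \<omega>_single[simplified] wt)
      moreover have "\<omega> (lm k) = n - j" using j k by (simp add: lm_def \<omega>_add \<omega>_single[simplified] wt)
      ultimately show ?thesis using j k by simp
    qed
  next
    fix j k v assume jk: "j < n" "k < n" "j \<noteq> k"
    have supp: "(0 < k \<and> v = z (k - 1)) \<or> v = z' k" if "lookup (lm k) v \<noteq> 0" for k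
      using that by (auto simp: lm_def lookup_add lookup_single when_def split: if_splits)
    show "lookup (lm j) v = 0 \<or> lookup (lm k) v = 0"
    proof (rule ccontr)
      assume "\<not> ?thesis"
      then have "(0 < j \<and> v = z (j - 1)) \<or> v = z' j" "(0 < k \<and> v = z (k - 1)) \<or> v = z' k"
        using supp by blast+
      then show False
        using jk less_imp_diff_less[OF jk(1), of 1] less_imp_diff_less[OF jk(2), of 1] by (auto simp: zz)
    qed
  qed (rule \<omega>_add)
  note closed = parity_ideal_closed[where E = E and 'k = 'k, folded I_def]
  have IA: "I \<subseteq> ideal_span A (2 + (n - 2))"
    unfolding I_def
  proof (rule parity_ideal_subsetI)
    let ?J = "ideal_span A (2 + (n - 2))"
    have J: "A k \<in> ?J" if "k < n" for k using that n by (intro generator_in_ideal_span) simp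
    have edge_le: "edge_poly (d i) (d j) \<in> ?J" if ij: "i < n" "j < n" "i = 0 \<or> j = Suc i" for i j
    proof (cases "i = 0")
      case True
      have "var (Inl (d 0)) \<in> ?J" "var (Inr (d 0)) \<in> ?J"
        using J[of 0] J[of 1] n by (auto simp: A_def z_def z'_def)
      then show ?thesis unfolding True edge_poly_def
        by (intro ideal_span_diff ideal_span_mult_right)
    next
      case False
      then have "g i \<in> ?J" using J[of "Suc i"] ij by (auto simp: A_def)
      then have "- g i \<in> ?J" "g i \<in> ?J" by (auto intro: ideal_span_uminus)
      then show ?thesis using g[of i] ij False by auto
    qed
    fix p p' assume "{p, p'} \<in> E"
    moreover obtain i j where ij: "i < n" "p = d i" "j < n" "p' = d j"
      using d by (metis UNIV_I atLeastLessThan_iff bij_betw_def imageE)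
    ultimately have "i = 0 \<or> j = 0 \<or> j = Suc i \<or> i = Suc j" using E by blast
    then show "edge_poly p p' \<in> ?J"
      using edge_le[of i j] edge_le[of j i] ij by (auto simp: edge_poly_commute)
  qed (auto intro: ideal_span_add ideal_span_mult)
  show ?thesis
  proof (rule le_reg[where A = A and p = 2])
    fix j :: nat assume "j < 2"
    then show "A j \<in> graded_maps 1 0"
      by (cases j) (auto simp: A_def var_def graded_maps_single)
  next
    fix k assume "k < n - 2"
    have "- edge_poly i j \<in> (graded_maps 2 0 :: ('v + 'v, 'k) mpoly set)" for i j
      using graded_maps_minus[OF graded_maps_0 edge_poly_graded, of i j] by simp
    moreover have "A (2 + k) = g (Suc k)" by (simp add: A_def)
    ultimately show "A (2 + k) \<in> graded_maps 2 0"
      using g[of "Suc k"] edge_poly_graded[of "d (Suc k)" "d (Suc (Suc k))"] by auto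
  next
    fix k f assume k: "k < n - 2" and f: "A (2 + k) * f \<in> ideal_span A (2 + k)"
    show "f \<in> ideal_span A (2 + k)" by (rule regular[OF _ f]) (use k in simp)
  next
    fix k assume k: "k < n - 2"
    then have "edge_poly (d (Suc k)) (d (Suc (Suc k))) \<in> I"
      unfolding I_def using path[of "Suc k"] by (intro edge_poly_in_parity_ideal) simp
    moreover from this have "0 - edge_poly (d (Suc k)) (d (Suc (Suc k))) \<in> I" by (intro closed)
    ultimately show "A (2 + k) \<in> I" using g[of "Suc k"] by (auto simp: A_def)
  next
    have "var v * f \<in> monomial_prime UNIV" for v and f :: "('v + 'v, 'k) mpoly"
      using monomial_prime_mult[OF var_in_monomial_prime[OF UNIV_I], of f v] by (simp add: mult.commute)
    then have "A k \<in> monomial_prime UNIV" for k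
      using monomial_prime_add[OF _ monomial_prime_uminus]
      by (fastforce simp: A_def g_def var_in_monomial_prime)
    then have "f \<in> monomial_prime UNIV" if "f \<in> ideal_span A k" for k f
      using that
    proof (induction k arbitrary: f)
      case (Suc k)
      then obtain h c where "h \<in> monomial_prime UNIV" "f = h + c * A k"
        unfolding ideal_span_Suc_iff by (auto simp: mult.commute)
      with Suc.prems(1) show ?case by (simp add: monomial_prime_add monomial_prime_mult)
    qed simp
    then show "ideal_span A (2 + (n - 2)) \<subseteq> irrelevant_ideal"
      by (auto simp flip: monomial_prime_UNIV)
  next
    fix f b assume "f \<in> I"
    then show "graded_part b 0 f \<in> I" unfolding I_def by (rule graded_part_parity_ideal)
  qed (use closed IA in auto)
qed

theorem proposition8p9:
  fixes n :: nat
    and C E :: "'v::finite set set"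
    and a b :: 'v
    and I :: "('v + 'v, 'k::alg_closed_field) mpoly set"
  assumes "CHAR('k) \<noteq> 2"
    and "cycle_graph n C" and "odd n"
    and "a \<noteq> b" and "{a, b} \<notin> C" and "E = insert {a, b} C"
    and "I = parity_binomial_edge_ideal E"
  shows "int (v_number I) \<le> reg I"
proof -
  obtain d L where d: "bij_betw d {0..<n} UNIV" and C: "C = {{d i, d (Suc i mod n)} | i. i < n}"
    and ab: "{a, b} = {d 0, d L}" and L: "even L" "2 \<le> L" "L + 3 \<le> n"
    using cycle_with_chord[OF assms(2-5)] .
  have E: "E = insert {d 0, d L} {{d i, d (Suc i mod n)} | i. i < n}"
    using assms(6) ab C by simp
  have path: "{d i, d (Suc i)} \<in> E" if "Suc i < n" for i
    unfolding E using that by (intro insertI2 CollectI exI[of _ i]) auto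
  have "{d (n - 1), d (Suc (n - 1) mod n)} \<in> E"
    unfolding E using L by (intro insertI2 CollectI exI[of _ "n - 1"]) auto
  then have last: "{d 0, d (n - 1)} \<in> E" using L by (simp add: insert_commute)
  have "(2::'k) \<noteq> 0"
  proof
    assume "(2::'k) = 0"
    then have "of_nat 2 = (0::'k)" by simp
    then have "CHAR('k) dvd 2" by (simp only: of_nat_eq_0_iff_char_dvd)
    then have "CHAR('k) \<le> 2" "CHAR('k) \<noteq> 0" by (simp add: dvd_imp_le, intro notI, simp)
    with assms(1) CHAR_not_1' show False by (metis le_Suc_eq le_zero_eq numeral_2_eq_2 One_nat_def)
  qed
  then have "v_number I \<le> n - 2"
    unfolding assms(7)
  proof (rule v_number_le_cycle_chord[where d = d and L = L])
    show "\<exists>i<n. p = d i" for p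
      using d by (metis UNIV_I atLeastLessThan_iff bij_betw_def imageE)
  qed (use path last L in \<open>simp_all add: E\<close>)
  moreover have "int (n - 2) \<le> reg I"
    unfolding assms(7)
  proof (rule le_reg_cycle_chord[OF d])
    fix i j assume ij: "i < n" "j < n" "{d i, d j} \<in> E"
    have inj: "d i = d j \<longleftrightarrow> i = j" if "i < n" "j < n" for i j
      using d that by (auto simp: bij_betw_def inj_on_def)
    from ij(3) consider "{d i, d j} = {d 0, d L}" | k where "k < n" "{d i, d j} = {d k, d (Suc k mod n)}"
      unfolding E by blast
    then show "i = 0 \<or> j = 0 \<or> j = Suc i \<or> i = Suc j"
    proof cases
      case 1
      then show ?thesis using ij(1,2) L inj by (auto simp: doubleton_eq_iff)
    next
      case 2
      then have "i = k \<and> j = Suc k mod n \<or> i = Suc k mod n \<and> j = k"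
        using ij(1,2) L inj by (auto simp: doubleton_eq_iff)
      then show ?thesis using 2(1) by (cases "Suc k = n") auto
    qed
  qed (use path L in auto)
  ultimately show ?thesis by linarith
qed

end
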